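(* Let $k\ge 2$ be an integer, $\epsilon>0$, $0<B_k\le B_{k+1}$ real numbers, and $f_0(z)=z$. Then there exists $C_k>1$, depending only on $k$, $\epsilon$ and $B_{k+1}$ (in particular not on $B_k$), such that for all $h_0\in C^\infty([-\epsilon,\epsilon];\mathbb{R})$, all $f,h\in C^k([-\epsilon,\epsilon];\mathbb{R})$ and all $\eta>0$, if, writing $B=h_0^{(k)}(0)$, $$\|h_0\|_{C^{k+1}}\le B_{k+1},\qquad |B|\ge B_k,\qquad 0<\eta<\frac{\min\{1,B_k\}}{2C_k},$$ $$\|h-h_0\|_{C^k}<\eta,\qquad \|f-f_0\|_{C^k}<\eta,\qquad f(0)>0,$$ then the following holds. Set $z_j=f^j(0)$ for integers $j$ with $|j|\le 2k$. For every $\tilde z_0\in(z_{-2k},z_{2k})$, setting $\tilde z_j=f^j(\tilde z_0)$ for $0\le j\le k$, we have $$\frac{B-C_k\eta}{k!}<[z_0,z_1,\dots,z_k;\,h(\tilde z_0),h(\tilde z_1),\dots,h(\tilde z_k)]<\frac{B+C_k\eta}{k!}.$$ In particular, the divided difference $[z_0,\dots,z_k;h(\tilde z_0),\dots,h(\tilde z_k)]$ has the same sign as $B$ and is therefore nonzero.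
   Context: For real numbers $x_0<x_1<\dots<x_k$ and $y_0,\dots,y_k$, the divided difference $[x_0,\dots,x_k;y_0,\dots,y_k]$ is the coefficient of $X^k$ in the unique real polynomial $P(X)$ of degree at most $k$ with $P(x_i)=y_i$ for $0\le i\le k$. $f^j$ denotes the $j$-fold iterate of $f$ under composition (not a power); $f^0$ is the identity and, for $j<0$, $f^j$ is the $|j|$-fold iterate of the inverse $f^{-1}$ of $f$ (defined on the image of $f$), each on its natural domain. The constant $C_k$ can be taken large enough (depending on $k$ and $\epsilon$) that the smallness of $\eta$ guarantees that all the points $z_j$ and $\tilde z_j$ involved are well defined and lie in $(-\epsilon,\epsilon)$. For a $C^r$ function $g$ on an interval, $\|g\|_{C^r}$ is the maximum over $0\le s\le r$ of the supremum of $|g^{(s)}|$ on the interval (here $[-\epsilon,\epsilon]$). *)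

theory Defs
  imports "HOL-Analysis.Analysis" "HOL-Computational_Algebra.Polynomial"
begin

text \<open>
  Functions on a real interval \<open>S\<close> are represented by total functions of which only the values
  on \<open>S\<close> matter; derivatives are taken within \<open>S\<close>, so they are one-sided at the end points.
\<close>

primrec nderiv_on :: "nat \<Rightarrow> real set \<Rightarrow> (real \<Rightarrow> real) \<Rightarrow> real \<Rightarrow> real" where
  "nderiv_on 0 S g = g"
| "nderiv_on (Suc n) S g = (\<lambda>x. vector_derivative (nderiv_on n S g) (at x within S))"

definition C_on :: "nat \<Rightarrow> real set \<Rightarrow> (real \<Rightarrow> real) \<Rightarrow> bool" where
  "C_on r S g \<longleftrightarrow>
     (\<forall>s<r. nderiv_on s S g differentiable_on S) \<and> continuous_on S (nderiv_on r S g)"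

definition C_infinity_on :: "real set \<Rightarrow> (real \<Rightarrow> real) \<Rightarrow> bool" where
  "C_infinity_on S g \<longleftrightarrow> (\<forall>r. C_on r S g)"

text \<open>Meaningful for \<open>C_on r S g\<close> with \<open>S\<close> compact and nonempty, where the suprema are finite.\<close>

definition C_norm :: "nat \<Rightarrow> real set \<Rightarrow> (real \<Rightarrow> real) \<Rightarrow> real" where
  "C_norm r S g = (MAX s\<in>{..r}. SUP x\<in>S. \<bar>nderiv_on s S g x\<bar>)"

text \<open>
  Integer iterates of the partial map \<open>f\<close> with domain \<open>S\<close>; negative ones iterate the inverse of
  this map, whose domain is \<open>f ` S\<close>. The value \<open>iterate_on S f j x\<close> is only meaningful when
  \<open>x\<close> lies in the natural domain of the \<open>j\<close>-th iterate, which is \<open>iterate_defined S f j x\<close>.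
\<close>

definition iterate_on :: "real set \<Rightarrow> (real \<Rightarrow> real) \<Rightarrow> int \<Rightarrow> real \<Rightarrow> real" where
  "iterate_on S f j x =
     (if j \<ge> 0 then (f ^^ nat j) x else (inv_into S f ^^ nat (- j)) x)"

definition iterate_defined :: "real set \<Rightarrow> (real \<Rightarrow> real) \<Rightarrow> int \<Rightarrow> real \<Rightarrow> bool" where
  "iterate_defined S f j x \<longleftrightarrow>
     (if j \<ge> 0 then \<forall>i<nat j. (f ^^ i) x \<in> S
      else inj_on f S \<and> (\<forall>i<nat (- j). (inv_into S f ^^ i) x \<in> f ` S))"

text \<open>
  \<open>divided_difference k x y\<close> is $[x_0,\dots,x_k;y_0,\dots,y_k]$; the interpolating polynomial
  exists and is unique when \<open>x\<close> is injective on \<open>{..k}\<close>.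
\<close>

definition divided_difference :: "nat \<Rightarrow> (nat \<Rightarrow> real) \<Rightarrow> (nat \<Rightarrow> real) \<Rightarrow> real" where
  "divided_difference k x y =
     coeff (THE P :: real poly. degree P \<le> k \<and> (\<forall>i\<le>k. poly P (x i) = y i)) k"

end

theory Submission
  imports Defs "HOL-Library.Landau_Symbols"
begin

text \<open>
  Write \<open>g(y) = f(y) - y\<close>, \<open>\<delta> = f(0)\<close>, and let \<open>d\<^sub>j = z\<^sub>j\<^sub>+\<^sub>1 - z\<^sub>j\<close> be the gaps of the orbit of \<open>0\<close> and
  \<open>w\<^sub>j = zt\<^sub>j - z\<^sub>j\<close> the displacement of the second orbit. The points of both orbits have modulus \<open>O(\<delta>)\<close>
  and the gaps are comparable to \<open>\<delta>\<close>. If the second orbit were the first one, the divided difference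
  would be \<open>h\<^sup>(\<^sup>k\<^sup>)(\<xi>) / k!\<close> for some \<open>\<xi>\<close> near \<open>0\<close>. The theorem holds because, as a function of the node
  \<open>z\<^sub>j\<close>, the point \<open>zt\<^sub>j\<close> is close to the identity in the discrete \<open>C\<^sup>k\<close> sense, uniformly in \<open>\<delta>\<close>, although
  \<open>\<delta>\<close> may be much smaller than \<open>\<eta>\<close> and differences of order \<open>k\<close> divide by \<open>\<delta>\<^sup>k\<close>.

  The discrete calculus uses the operator \<open>\<Delta>a\<^sub>j = (a\<^sub>j\<^sub>+\<^sub>1 - a\<^sub>j) / d\<^sub>j\<close>, which is iterated instead of taking
  higher divided differences. It has a product rule (\<open>bdiff_mult\<close>) and a reciprocal rule
  (\<open>bdiff_inverse\<close>), and errors of size \<open>\<eta> \<delta>\<^sup>m\<close> are harmless up to order \<open>m\<close> (\<open>bdiff_small_values\<close>). By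
  Taylor's formula \<open>g\<close> may therefore be replaced by a polynomial of degree less than \<open>k\<close> with
  coefficients \<open>O(\<eta>)\<close>.

  Let \<open>v\<^sub>j = w\<^sub>j / d\<^sub>j\<close>. Up to remainders, \<open>\<Delta>d = g[z, z + d]\<close>, \<open>\<Delta>w = v g[z, zt]\<close> and
  \<open>\<Delta>v = v (v - 1) g[z, z + d, zt] / (1 + \<Delta>d)\<close>. The last identity is the decisive one
  (\<open>rel_diff_scaled_offset\<close>): no negative power of \<open>\<delta>\<close> occurs on its right-hand side, and \<open>v\<^sub>0\<close> is bounded
  since the second orbit starts between \<open>z\<^sub>-\<^sub>2\<^sub>k\<close> and \<open>z\<^sub>2\<^sub>k\<close>. Raising the order one by one, \<open>v\<close> has bounded
  differences up to order \<open>k - 1\<close>, and then \<open>w\<close> has differences \<open>O(\<eta>)\<close> up to order \<open>k\<close> (\<open>bdiff_offset\<close>).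

  Expanding \<open>h\<close> at \<open>0\<close>, the values \<open>h(zt\<^sub>j)\<close> are, up to \<open>O(\<eta> \<delta>\<^sup>k)\<close>, a polynomial of degree \<open>k\<close> in
  \<open>zt\<^sub>j\<close> with leading coefficient \<open>B / k!\<close>, and replacing \<open>zt\<^sub>j\<close> by \<open>z\<^sub>j\<close> in it changes the differences only
  by \<open>O(\<eta>)\<close>. Since \<open>\<Delta>\<close> acts on powers of
  \<open>z\<close> like the derivative up to \<open>O(\<eta>)\<close>, a polynomial with small differences has small coefficients
  (\<open>coefficients_bigo\<close>), so the interpolation polynomial has leading coefficient \<open>B / k! + O(\<eta>)\<close>.

  That the constant depends on \<open>k\<close>, \<open>\<epsilon>\<close> and \<open>Bk1\<close> only is obtained by working with families: all sequences
  depend on an index that runs through all admissible data, and every bound is a Landau bound along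
  the filter \<open>\<eta> \<rightarrow> 0\<close> on this index set.
\<close>

section \<open>Iterated differences relative to the gaps of a node sequence\<close>

definition rel_diff :: "(nat \<Rightarrow> real) \<Rightarrow> (nat \<Rightarrow> real) \<Rightarrow> nat \<Rightarrow> real" where
  "rel_diff d a j = (a (Suc j) - a j) / d j"

text \<open>
  The index \<open>i\<close> ranges over all data that a uniform estimate has to cover, and the filter \<open>F\<close> says
  in which direction the data degenerate. A bound in \<open>O[F](g)\<close> is then an estimate whose constant is
  the same for all these data, and no constant has to be named. The numbers \<open>d i j\<close> are the gaps
  between consecutive nodes.
\<close>

locale node_family =
  fixes F :: "'i filter" and d :: "'i \<Rightarrow> nat \<Rightarrow> real"
begin

abbreviation \<Delta> :: "('i \<Rightarrow> nat \<Rightarrow> real) \<Rightarrow> 'i \<Rightarrow> nat \<Rightarrow> real" where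
  "\<Delta> a \<equiv> (\<lambda>i. rel_diff (d i) (a i))"

text \<open>
  Only the differences that start at index \<open>0\<close> are recorded; those that start later can be recovered
  from \<open>a\<^sub>j\<^sub>+\<^sub>1 = a\<^sub>j + d\<^sub>j \<Delta>a\<^sub>j\<close>. This choice makes the notion recursive in \<open>m\<close>.
\<close>

definition bdiff :: "nat \<Rightarrow> ('i \<Rightarrow> real) \<Rightarrow> ('i \<Rightarrow> nat \<Rightarrow> real) \<Rightarrow> bool" where
  "bdiff m g a \<longleftrightarrow> (\<forall>r\<le>m. (\<lambda>i. (rel_diff (d i) ^^ r) (a i) 0) \<in> O[F](g))"

lemma bdiff_0: "bdiff 0 g a \<longleftrightarrow> (\<lambda>i. a i 0) \<in> O[F](g)"
  by (simp add: bdiff_def)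

lemma bdiff_Suc: "bdiff (Suc m) g a \<longleftrightarrow> (\<lambda>i. a i 0) \<in> O[F](g) \<and> bdiff m g (\<Delta> a)"
proof -
  have "(\<forall>r\<le>Suc m. P r) \<longleftrightarrow> P 0 \<and> (\<forall>r\<le>m. P (Suc r))" for P
    by (metis Suc_le_mono le0 not0_implies_Suc)
  then show ?thesis
    by (simp add: bdiff_def funpow_swap1)
qed

lemma bdiff_mono: "bdiff m g a \<Longrightarrow> n \<le> m \<Longrightarrow> g \<in> O[F](g') \<Longrightarrow> bdiff n g' a"
  unfolding bdiff_def by (meson landau_o.big_trans le_trans)

lemma bdiff_order: "bdiff m g a \<Longrightarrow> n \<le> m \<Longrightarrow> bdiff n g a"
  by (simp add: bdiff_def)

lemma bdiff_cong:
  assumes "bdiff m g b" "\<forall>\<^sub>F i in F. \<forall>j\<le>m. a i j = b i j"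
  shows "bdiff m g a"
  using assms
proof (induction m arbitrary: a b)
  case 0
  have "(\<lambda>i. a i 0) \<in> O[F](g) \<longleftrightarrow> (\<lambda>i. b i 0) \<in> O[F](g)"
    by (rule landau_o.big.in_cong) (use 0 in auto)
  then show ?case using 0 by (simp add: bdiff_0)
next
  case (Suc m)
  have "(\<lambda>i. a i 0) \<in> O[F](g) \<longleftrightarrow> (\<lambda>i. b i 0) \<in> O[F](g)"
    by (rule landau_o.big.in_cong) (use Suc.prems in \<open>auto elim: eventually_mono\<close>)
  moreover have "bdiff m g (\<Delta> a)"
  proof (rule Suc.IH)
    show "bdiff m g (\<Delta> b)" using Suc.prems by (simp add: bdiff_Suc)
    show "\<forall>\<^sub>F i in F. \<forall>j\<le>m. \<Delta> a i j = \<Delta> b i j"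
      using Suc.prems(2) by eventually_elim (simp add: rel_diff_def)
  qed
  ultimately show ?case using Suc.prems by (simp add: bdiff_Suc)
qed

lemma bdiff_const: "c \<in> O[F](g) \<Longrightarrow> bdiff m g (\<lambda>i j. c i)"
proof (induction m arbitrary: c)
  case (Suc m)
  have "\<Delta> (\<lambda>i j. c i) = (\<lambda>i j. 0)" by (simp add: rel_diff_def fun_eq_iff)
  then show ?case using Suc.IH[of "\<lambda>_. 0"] Suc.prems by (simp add: bdiff_Suc)
qed (simp add: bdiff_0)

lemma bdiff_add: "bdiff m g a \<Longrightarrow> bdiff m g b \<Longrightarrow> bdiff m g (\<lambda>i j. a i j + b i j)"
proof (induction m arbitrary: a b)
  case (Suc m)
  have "\<Delta> (\<lambda>i j. a i j + b i j) = (\<lambda>i j. \<Delta> a i j + \<Delta> b i j)"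
    by (simp add: rel_diff_def fun_eq_iff diff_divide_distrib add_divide_distrib)
  then show ?case using Suc by (simp add: bdiff_Suc sum_in_bigo)
qed (simp add: bdiff_0 sum_in_bigo)

lemma bdiff_sum: "(\<And>l. l \<in> A \<Longrightarrow> bdiff m g (\<lambda>i. a l i)) \<Longrightarrow> bdiff m g (\<lambda>i j. \<Sum>l\<in>A. a l i j)"
  by (induction A rule: infinite_finite_induct) (auto simp: bdiff_const intro: bdiff_add)

text \<open>
  The discrete Leibniz rule \<open>\<Delta>(ab) = \<Delta>a b + a \<Delta>b + d \<Delta>a \<Delta>b\<close> has only one term that a derivation would
  not have. It contains the gaps as a factor, so products need control of \<open>d\<close> itself, but of one
  order less than the order that is claimed.
\<close>

lemma bdiff_mult:
  assumes "bdiff m g a" "bdiff m g' b" "bdiff (m - 1) (\<lambda>_. 1) d"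
  shows "bdiff m (\<lambda>i. g i * g' i) (\<lambda>i j. a i j * b i j)"
  using assms
proof (induction m arbitrary: a b g g')
  case 0
  then show ?case by (simp add: bdiff_0 landau_o.big.mult)
next
  case (Suc m)
  note IH = Suc.IH[OF _ _ bdiff_order[OF Suc.prems(3)], simplified]
  have a: "bdiff m g a" "bdiff m g (\<Delta> a)" "(\<lambda>i. a i 0) \<in> O[F](g)"
    and b: "bdiff m g' b" "bdiff m g' (\<Delta> b)" "(\<lambda>i. b i 0) \<in> O[F](g')"
    using Suc.prems bdiff_order[of "Suc m" _ _ m] by (auto simp: bdiff_Suc)
  have dd: "bdiff m (\<lambda>_. 1) d" using Suc.prems(3) by simp
  have "\<Delta> (\<lambda>i j. a i j * b i j)
      = (\<lambda>i j. \<Delta> a i j * b i j + a i j * \<Delta> b i j + d i j * (\<Delta> a i j * \<Delta> b i j))"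
  proof (intro ext)
    fix i j
    show "\<Delta> (\<lambda>i j. a i j * b i j) i j
      = \<Delta> a i j * b i j + a i j * \<Delta> b i j + d i j * (\<Delta> a i j * \<Delta> b i j)"
      by (cases "d i j = 0") (simp_all add: rel_diff_def field_simps)
  qed
  moreover have "bdiff m (\<lambda>i. g i * g' i)
      (\<lambda>i j. \<Delta> a i j * b i j + a i j * \<Delta> b i j + d i j * (\<Delta> a i j * \<Delta> b i j))"
    using IH[OF a(2) b(1)] IH[OF a(1) b(2)] IH[OF dd IH[OF a(2) b(2)]]
    by (intro bdiff_add) simp_all
  ultimately show ?case using a b by (simp add: bdiff_Suc landau_o.big.mult)
qed

lemma bdiff_mult_1:
  assumes "bdiff m (\<lambda>_. 1) a" "bdiff m g b" "bdiff (m - 1) (\<lambda>_. 1) d"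
  shows "bdiff m g (\<lambda>i j. a i j * b i j)"
  using bdiff_mult[OF assms] by simp

lemma bdiff_cmult:
  assumes "c \<in> O[F](g)" "bdiff m (\<lambda>_. 1) b" "bdiff (m - 1) (\<lambda>_. 1) d"
  shows "bdiff m g (\<lambda>i j. c i * b i j)"
  using bdiff_mult[OF bdiff_const[OF assms(1)] assms(2,3)] by simp

lemma bdiff_diff: "bdiff m g a \<Longrightarrow> bdiff m g b \<Longrightarrow> bdiff m g (\<lambda>i j. a i j - b i j)"
proof (induction m arbitrary: a b)
  case (Suc m)
  have "\<Delta> (\<lambda>i j. a i j - b i j) = (\<lambda>i j. \<Delta> a i j - \<Delta> b i j)"
    by (simp add: rel_diff_def fun_eq_iff diff_divide_distrib add_divide_distrib)
  then show ?case using Suc by (simp add: bdiff_Suc sum_in_bigo)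
qed (simp add: bdiff_0 sum_in_bigo)

lemma bdiff_power:
  assumes "bdiff m (\<lambda>_. 1) a" "bdiff (m - 1) (\<lambda>_. 1) d"
  shows "bdiff m (\<lambda>_. 1) (\<lambda>i j. a i j ^ n)"
  by (induction n) (use assms in \<open>auto intro!: bdiff_const bdiff_mult_1\<close>)

text \<open>
  For \<open>b = 1 + s\<close>, from \<open>\<Delta>(1/b)\<^sub>j = - \<Delta>b\<^sub>j / (b\<^sub>j b\<^sub>j\<^sub>+\<^sub>1)\<close> and \<open>b\<^sub>j\<^sub>+\<^sub>1 = b\<^sub>j + d\<^sub>j \<Delta>b\<^sub>j\<close> the order can be raised one by one; the
  induction hypothesis is applied both to the sequence and to its shift.
\<close>

lemma bdiff_inverse:
  assumes "bdiff m \<eta> s" "bdiff (m - 1) (\<lambda>_. 1) d" "(\<eta> \<longlongrightarrow> 0) F"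
    and "\<forall>\<^sub>F i in F. \<forall>j<m. d i j \<noteq> 0" "\<forall>\<^sub>F i in F. \<forall>j\<le>m. 1 + s i j \<noteq> 0"
  shows "bdiff m (\<lambda>_. 1) (\<lambda>i j. inverse (1 + s i j))"
  using assms(1,2,4,5)
proof (induction m arbitrary: s)
  have base: "(\<lambda>i. inverse (1 + s i 0)) \<in> O[F](\<lambda>_. 1)" if "(\<lambda>i. s i 0) \<in> O[F](\<eta>)" for s :: "'i \<Rightarrow> nat \<Rightarrow> real"
  proof -
    have "\<eta> \<in> o[F](\<lambda>_. 1)" using assms(3) by (intro smalloI_tendsto) auto
    with that have "(\<lambda>i. s i 0) \<in> o[F](\<lambda>_. 1)" by (rule landau_o.big_small_trans)
    then have "((\<lambda>i. s i 0) \<longlongrightarrow> 0) F" by (auto dest: smalloD_tendsto)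
    then have "((\<lambda>i. inverse (1 + s i 0)) \<longlongrightarrow> inverse (1 + 0)) F"
      by (intro tendsto_intros) auto
    then show ?thesis
      by (intro bigoI_tendsto[where c = 1]) auto
  qed
  {
    case 0
    then show ?case using base by (simp add: bdiff_0)
  next
    case (Suc m)
    have dm: "bdiff (m - 1) (\<lambda>_. 1) d" using Suc.prems(2) by (rule bdiff_order) simp
    have dd: "bdiff m (\<lambda>_. 1) d" using Suc.prems(2) by simp
    have s: "bdiff m \<eta> s" "bdiff m \<eta> (\<Delta> s)" "(\<lambda>i. s i 0) \<in> O[F](\<eta>)"
      using Suc.prems bdiff_order[of "Suc m" _ _ m] by (auto simp: bdiff_Suc)
    \<comment> \<open>The shift of \<open>s\<close>, written so that its differences are visibly under control.\<close>
    define t where "t = (\<lambda>i j. s i j + d i j * \<Delta> s i j)"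
    have t: "bdiff m \<eta> t"
      unfolding t_def using s dd dm by (intro bdiff_add bdiff_mult_1)
    have t_eq: "\<forall>\<^sub>F i in F. \<forall>j\<le>m. t i j = s i (Suc j)"
      using Suc.prems(3) by eventually_elim (simp add: t_def rel_diff_def)
    have nz: "\<forall>\<^sub>F i in F. \<forall>j\<le>m. 1 + s i j \<noteq> 0" "\<forall>\<^sub>F i in F. \<forall>j\<le>m. 1 + t i j \<noteq> 0"
      using Suc.prems(4) t_eq by (eventually_elim, simp)+
    have d_nz: "\<forall>\<^sub>F i in F. \<forall>j<m. d i j \<noteq> 0"
      using Suc.prems(3) by eventually_elim simp
    have ev: "\<forall>\<^sub>F i in F. \<forall>j\<le>m. \<Delta> (\<lambda>i j. inverse (1 + s i j)) i j
         = (- 1) * (inverse (1 + s i j) * (inverse (1 + t i j) * \<Delta> s i j))"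
      using nz t_eq Suc.prems(3)
    proof eventually_elim
      case (elim i)
      show ?case
      proof (intro allI impI)
        fix j assume "j \<le> m"
        then have "1 + s i j \<noteq> 0" "1 + s i (Suc j) \<noteq> 0" "d i j \<noteq> 0" "t i j = s i (Suc j)"
          using elim by auto
        then show "\<Delta> (\<lambda>i j. inverse (1 + s i j)) i j
         = (- 1) * (inverse (1 + s i j) * (inverse (1 + t i j) * \<Delta> s i j))"
          by (simp add: rel_diff_def divide_simps)
      qed
    qed
    have "bdiff m \<eta> (\<lambda>i j. (- 1) * (inverse (1 + s i j) * (inverse (1 + t i j) * \<Delta> s i j)))"
      by (intro bdiff_mult_1 bdiff_const Suc.IH s t dm nz d_nz) auto
    then have "bdiff m \<eta> (\<Delta> (\<lambda>i j. inverse (1 + s i j)))"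
      using ev by (rule bdiff_cong)
    moreover have "\<eta> \<in> O[F](\<lambda>_. 1)" using assms(3) by (intro bigoI_tendsto) auto
    ultimately have "bdiff m (\<lambda>_. 1) (\<Delta> (\<lambda>i j. inverse (1 + s i j)))"
      by (blast intro: bdiff_mono)
    then show ?case using base[of s, OF s(3)] by (simp add: bdiff_Suc)
  }
qed

text \<open>
  Each of the \<open>m\<close> differences divides by a gap that is at least comparable to \<open>\<delta>\<close>, so a pointwise size
  \<open>g \<delta>\<^sup>m\<close> is small enough to neglect all cancellation. This is how Taylor remainders are disposed of.
\<close>

lemma bdiff_small_values:
  assumes "\<And>j. j \<le> m \<Longrightarrow> (\<lambda>i. a i j) \<in> O[F](\<lambda>i. g i * \<delta> i ^ m)"
    and "\<And>j. j < m \<Longrightarrow> (\<lambda>i. 1 / d i j) \<in> O[F](\<lambda>i. 1 / \<delta> i)"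
    and "\<delta> \<in> O[F](\<lambda>_. 1)" "\<forall>\<^sub>F i in F. \<delta> i \<noteq> 0"
  shows "bdiff m g a"
  using assms(1,2)
proof (induction m arbitrary: a)
  case 0
  then show ?case by (simp add: bdiff_0)
next
  case (Suc m)
  have "(\<lambda>i. g i * \<delta> i ^ Suc m) \<in> O[F](\<lambda>i. g i * 1 ^ Suc m)"
    by (intro landau_o.big.mult landau_o.big_power assms) auto
  then have "(\<lambda>i. a i 0) \<in> O[F](g)"
    using Suc.prems(1)[of 0] by (simp add: landau_o.big_trans)
  moreover have "bdiff m g (\<Delta> a)"
  proof (rule Suc.IH)
    fix j assume j: "j \<le> m"
    have "(\<lambda>i. (a i (Suc j) - a i j) * (1 / d i j)) \<in> O[F](\<lambda>i. (g i * \<delta> i ^ Suc m) * (1 / \<delta> i))"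
      using j by (intro landau_o.big.mult sum_in_bigo Suc.prems) auto
    also have "(\<lambda>i. (g i * \<delta> i ^ Suc m) * (1 / \<delta> i)) \<in> O[F](\<lambda>i. g i * \<delta> i ^ m)"
      by (rule bigoI[of _ 1]) (use assms(4) in eventually_elim, simp)
    finally show "(\<lambda>i. \<Delta> a i j) \<in> O[F](\<lambda>i. g i * \<delta> i ^ m)" by (simp add: rel_diff_def)
  qed (use Suc.prems in auto)
  ultimately show ?case by (simp add: bdiff_Suc)
qed

end

section \<open>Two orbits compared on the nodes of the first\<close>

text \<open>
  Two orbits \<open>z\<close> and \<open>zt\<close> of the same map \<open>y \<mapsto> y + g(y)\<close>, where \<open>g\<close> has been replaced by its Taylor
  polynomial with coefficients \<open>a l\<close>, up to an error \<open>O(\<eta> \<delta>\<^sup>k)\<close> in each step. The number \<open>\<delta>\<close> is the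
  length of a step near \<open>0\<close> and \<open>\<eta>\<close> the size of the map \<open>g\<close>. As \<open>\<delta>\<close> may be arbitrarily small compared to
  \<open>\<eta>\<close>, bounds that are uniform in \<open>\<delta>\<close> have to come from cancellation.
\<close>

locale orbit_pair_family =
  fixes F :: "'i filter" and k :: nat
    and z zt :: "'i \<Rightarrow> nat \<Rightarrow> real" and \<delta> \<eta> :: "'i \<Rightarrow> real" and a :: "nat \<Rightarrow> 'i \<Rightarrow> real"
  assumes z_start: "z i 0 = 0"
    and \<eta>_tendsto: "(\<eta> \<longlongrightarrow> 0) F"
    and \<delta>_pos: "\<forall>\<^sub>F i in F. 0 < \<delta> i"
    and \<delta>_le: "\<delta> \<in> O[F](\<eta>)"
    and z_bigo: "\<And>j. j \<le> k \<Longrightarrow> (\<lambda>i. z i j) \<in> O[F](\<delta>)"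
    and zt_bigo: "\<And>j. j \<le> k \<Longrightarrow> (\<lambda>i. zt i j) \<in> O[F](\<delta>)"
    and gap: "\<And>j. j < k \<Longrightarrow> \<forall>\<^sub>F i in F. \<delta> i \<le> 2 * (z i (Suc j) - z i j)"
    and a_bigo: "\<And>l. l < k \<Longrightarrow> a l \<in> O[F](\<eta>)"
    and z_step: "\<And>j. j < k \<Longrightarrow>
      (\<lambda>i. z i (Suc j) - z i j - (\<Sum>l<k. a l i * z i j ^ l)) \<in> O[F](\<lambda>i. \<eta> i * \<delta> i ^ k)"
    and zt_step: "\<And>j. j < k \<Longrightarrow>
      (\<lambda>i. zt i (Suc j) - zt i j - (\<Sum>l<k. a l i * zt i j ^ l)) \<in> O[F](\<lambda>i. \<eta> i * \<delta> i ^ k)"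
begin

definition d :: "'i \<Rightarrow> nat \<Rightarrow> real" where
  "d i j = z i (Suc j) - z i j"

sublocale node_family F d .

lemma \<eta>_bigo_1: "\<eta> \<in> O[F](\<lambda>_. 1)"
  using \<eta>_tendsto by (intro bigoI_tendsto) auto

lemma \<delta>_bigo_1: "\<delta> \<in> O[F](\<lambda>_. 1)"
  using \<delta>_le \<eta>_bigo_1 by (rule landau_o.big_trans)

lemma \<delta>_nonzero: "\<forall>\<^sub>F i in F. \<delta> i \<noteq> 0"
  using \<delta>_pos by eventually_elim simp

lemma \<delta>_power_mono: "m \<le> n \<Longrightarrow> (\<lambda>i. \<eta> i * \<delta> i ^ n) \<in> O[F](\<lambda>i. \<eta> i * \<delta> i ^ m)"
proof -
  assume "m \<le> n"
  have "(\<lambda>i. \<eta> i * \<delta> i ^ m * \<delta> i ^ (n - m)) \<in> O[F](\<lambda>i. \<eta> i * \<delta> i ^ m * 1 ^ (n - m))"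
    by (intro landau_o.big.mult landau_o.big_power \<delta>_bigo_1) auto
  with \<open>m \<le> n\<close> show ?thesis by (simp add: mult.assoc flip: power_add)
qed

lemma gap_inverse: "j < k \<Longrightarrow> (\<lambda>i. 1 / d i j) \<in> O[F](\<lambda>i. 1 / \<delta> i)"
proof (rule bigoI[of _ 2])
  assume "j < k"
  show "\<forall>\<^sub>F i in F. norm (1 / d i j) \<le> 2 * norm (1 / \<delta> i)"
    using gap[OF \<open>j < k\<close>] \<delta>_pos by eventually_elim (simp add: d_def field_simps)
qed

lemma bdiff_error:
  assumes "m \<le> k" "\<And>j. j \<le> m \<Longrightarrow> (\<lambda>i. e i j) \<in> O[F](\<lambda>i. \<eta> i * \<delta> i ^ m)"
  shows "bdiff m \<eta> e"
  by (rule bdiff_small_values[where \<delta> = \<delta>])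
     (use assms gap_inverse \<delta>_bigo_1 \<delta>_nonzero in auto)

lemma gaps_nonzero: "m \<le> k \<Longrightarrow> \<forall>\<^sub>F i in F. \<forall>j<m. d i j \<noteq> 0"
proof -
  assume "m \<le> k"
  have "\<forall>\<^sub>F i in F. \<forall>j\<in>{..<k}. \<delta> i \<le> 2 * (z i (Suc j) - z i j)"
    by (rule eventually_ball_finite) (use gap in auto)
  with \<delta>_pos show ?thesis
  proof eventually_elim
    case (elim i)
    show ?case
    proof (intro allI impI)
      fix j assume "j < m"
      with \<open>m \<le> k\<close> elim(2) have "\<delta> i \<le> 2 * d i j" by (auto simp: d_def)
      with elim(1) show "d i j \<noteq> 0" by auto
    qed
  qed
qed

definition step_err :: "('i \<Rightarrow> nat \<Rightarrow> real) \<Rightarrow> 'i \<Rightarrow> nat \<Rightarrow> real" where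
  "step_err x i j = x i (Suc j) - x i j - (\<Sum>l<k. a l i * x i j ^ l)"

lemma step_err_z: "j < k \<Longrightarrow> (\<lambda>i. step_err z i j) \<in> O[F](\<lambda>i. \<eta> i * \<delta> i ^ k)"
  and step_err_zt: "j < k \<Longrightarrow> (\<lambda>i. step_err zt i j) \<in> O[F](\<lambda>i. \<eta> i * \<delta> i ^ k)"
  using z_step zt_step by (simp_all add: step_err_def)

lemma divide_gap:
  assumes "j < k" "n \<ge> 1" "(\<lambda>i. e i j) \<in> O[F](\<lambda>i. \<eta> i * \<delta> i ^ n)"
  shows "(\<lambda>i. e i j / d i j) \<in> O[F](\<lambda>i. \<eta> i * \<delta> i ^ (n - 1))"
proof -
  have "(\<lambda>i. e i j * (1 / d i j)) \<in> O[F](\<lambda>i. \<eta> i * \<delta> i ^ n * (1 / \<delta> i))"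
    by (intro landau_o.big.mult assms gap_inverse)
  also have "(\<lambda>i. \<eta> i * \<delta> i ^ n * (1 / \<delta> i)) \<in> O[F](\<lambda>i. \<eta> i * \<delta> i ^ (n - 1))"
  proof (rule bigoI[of _ 1], use \<delta>_nonzero in eventually_elim)
    case (elim i)
    then show ?case using assms(2) by (cases n) auto
  qed
  finally show ?thesis by simp
qed

text \<open>
  The divided difference \<open>g[x, y]\<close> of the Taylor polynomial \<open>g\<close>, written as a polynomial in \<open>x\<close> and
  \<open>y\<close> so that it makes sense on the diagonal and is estimated by the product rule.
\<close>

definition slope :: "('i \<Rightarrow> nat \<Rightarrow> real) \<Rightarrow> ('i \<Rightarrow> nat \<Rightarrow> real) \<Rightarrow> 'i \<Rightarrow> nat \<Rightarrow> real" where
  "slope x y i j = (\<Sum>l<k. a l i * (\<Sum>p<l. x i j ^ (l - Suc p) * y i j ^ p))"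

lemma slope_eq:
  "(\<Sum>l<k. a l i * y i j ^ l) - (\<Sum>l<k. a l i * x i j ^ l) = (y i j - x i j) * slope x y i j"
  unfolding slope_def sum_subtractf[symmetric] sum_distrib_left right_diff_distrib[symmetric]
  by (rule sum.cong[OF refl]) (simp only: power_diff_sumr2 sum_distrib_left mult.left_commute)

text \<open>
  The second divided difference \<open>g[x, u, y]\<close>, in the same polynomial form.
\<close>

definition curvature ::
  "('i \<Rightarrow> nat \<Rightarrow> real) \<Rightarrow> ('i \<Rightarrow> nat \<Rightarrow> real) \<Rightarrow> ('i \<Rightarrow> nat \<Rightarrow> real) \<Rightarrow> 'i \<Rightarrow> nat \<Rightarrow> real" where
  "curvature x u y i j = (\<Sum>l<k. a l i * (\<Sum>p<l. x i j ^ (l - Suc p) *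
     (\<Sum>q<p. u i j ^ (p - Suc q) * y i j ^ q)))"

lemma curvature_eq: "slope x y i j - slope x u i j = (y i j - u i j) * curvature x u y i j"
  unfolding slope_def curvature_def sum_subtractf[symmetric] sum_distrib_left right_diff_distrib[symmetric]
  by (intro sum.cong[OF refl]) (simp only: power_diff_sumr2 sum_distrib_left mult.left_commute)

lemma bdiff_slope:
  assumes "bdiff m (\<lambda>_. 1) x" "bdiff m (\<lambda>_. 1) y" "bdiff (m - 1) (\<lambda>_. 1) d"
  shows "bdiff m \<eta> (slope x y)"
  unfolding slope_def using assms
  by (intro bdiff_sum bdiff_cmult bdiff_mult_1 bdiff_power a_bigo) auto

lemma bdiff_curvature:
  assumes "bdiff m (\<lambda>_. 1) x" "bdiff m (\<lambda>_. 1) u" "bdiff m (\<lambda>_. 1) y" "bdiff (m - 1) (\<lambda>_. 1) d"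
  shows "bdiff m \<eta> (curvature x u y)"
  unfolding curvature_def using assms
  by (intro bdiff_sum bdiff_cmult bdiff_mult_1 bdiff_power a_bigo) auto

definition next_z :: "'i \<Rightarrow> nat \<Rightarrow> real" where
  "next_z i j = z i j + d i j"

lemma next_z_eq: "next_z i j = z i (Suc j)"
  by (simp add: next_z_def d_def)

lemma bdiff_z: "m \<le> k \<Longrightarrow> bdiff m (\<lambda>_. 1) z"
proof (cases m)
  case 0
  then show ?thesis by (simp add: bdiff_0 z_start)
next
  case (Suc n)
  assume "m \<le> k"
  have "bdiff n (\<lambda>_. 1) (\<Delta> z)"
  proof (rule bdiff_cong)
    show "bdiff n (\<lambda>_. 1) (\<lambda>i j. 1)" by (rule bdiff_const) simp
    show "\<forall>\<^sub>F i in F. \<forall>j\<le>n. \<Delta> z i j = 1"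
      using gaps_nonzero[OF \<open>m \<le> k\<close>] by eventually_elim (simp add: Suc rel_diff_def d_def)
  qed
  then show ?thesis by (simp add: Suc bdiff_Suc z_start)
qed

lemma bdiff_next_z: "m \<le> k \<Longrightarrow> bdiff m (\<lambda>_. 1) d \<Longrightarrow> bdiff m (\<lambda>_. 1) next_z"
  unfolding next_z_def by (intro bdiff_add bdiff_z)

definition gap_err :: "'i \<Rightarrow> nat \<Rightarrow> real" where
  "gap_err i j = (step_err z i (Suc j) - step_err z i j) / d i j"

lemma gap_err_bigo: "Suc j < k \<Longrightarrow> (\<lambda>i. gap_err i j) \<in> O[F](\<lambda>i. \<eta> i * \<delta> i ^ (k - 1))"
  unfolding gap_err_def by (rule divide_gap) (auto intro!: sum_in_bigo step_err_z)

text \<open>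
  The gaps satisfy \<open>d\<^sub>j\<^sub>+\<^sub>1 - d\<^sub>j = g(z\<^sub>j\<^sub>+\<^sub>1) - g(z\<^sub>j) = d\<^sub>j g[z\<^sub>j, z\<^sub>j\<^sub>+\<^sub>1]\<close>, up to the Taylor remainders. Measured
  against the gaps themselves, the relative change is thus \<open>O(\<eta>)\<close>, whereas ordinary second
  differences of the nodes, divided by \<open>\<delta>\<^sup>2\<close>, may be unbounded.
\<close>

lemma rel_diff_gap: "d i j \<noteq> 0 \<Longrightarrow> \<Delta> d i j = slope z next_z i j + gap_err i j"
proof -
  assume nz: "d i j \<noteq> 0"
  have "d i (Suc j) - d i j = (\<Sum>l<k. a l i * next_z i j ^ l) - (\<Sum>l<k. a l i * z i j ^ l)
     + (step_err z i (Suc j) - step_err z i j)"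
    by (simp add: next_z_eq d_def step_err_def)
  also have "\<dots> = d i j * slope z next_z i j + (step_err z i (Suc j) - step_err z i j)"
    unfolding slope_eq by (simp add: next_z_def)
  finally show ?thesis
    using nz by (simp add: rel_diff_def gap_err_def add_divide_distrib)
qed

lemma bdiff_gap: "m < k \<Longrightarrow> bdiff m \<eta> d"
proof (induction m)
  case 0
  have "(\<lambda>i. d i 0) \<in> O[F](\<delta>)"
    unfolding d_def using 0 by (intro sum_in_bigo z_bigo) auto
  then show ?case using \<delta>_le by (simp add: bdiff_0 landau_o.big_trans)
next
  case (Suc m)
  have "bdiff m (\<lambda>_. 1) d"
    using Suc \<eta>_bigo_1 by (auto intro: bdiff_mono)
  then have "bdiff m \<eta> (slope z next_z)"
    using Suc.prems by (intro bdiff_slope bdiff_next_z bdiff_z) (auto intro: bdiff_order)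
  moreover have "bdiff m \<eta> gap_err"
  proof (rule bdiff_error)
    fix j assume "j \<le> m"
    then have "(\<lambda>i. gap_err i j) \<in> O[F](\<lambda>i. \<eta> i * \<delta> i ^ (k - 1))"
      using Suc.prems by (intro gap_err_bigo) auto
    then show "(\<lambda>i. gap_err i j) \<in> O[F](\<lambda>i. \<eta> i * \<delta> i ^ m)"
      using Suc.prems \<delta>_power_mono[of m "k - 1"] by (auto intro: landau_o.big_trans)
  qed (use Suc.prems in auto)
  ultimately have "bdiff m \<eta> (\<lambda>i j. slope z next_z i j + gap_err i j)"
    by (rule bdiff_add)
  then have "bdiff m \<eta> (\<Delta> d)"
    by (rule bdiff_cong)
       (use gaps_nonzero[of "Suc m"] Suc.prems in \<open>auto elim!: eventually_mono simp: rel_diff_gap\<close>)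
  moreover have "bdiff 0 \<eta> d" using Suc by (auto intro: bdiff_order)
  ultimately show ?case by (simp add: bdiff_Suc bdiff_0)
qed

lemma bdiff_gap_1: "m < k \<Longrightarrow> bdiff m (\<lambda>_. 1) d"
  using bdiff_gap \<eta>_bigo_1 bdiff_mono by blast

definition offset :: "'i \<Rightarrow> nat \<Rightarrow> real" where
  "offset i j = zt i j - z i j"

text \<open>
  The displacement in units of the current gap, called \<open>v\<close> in the explanations: roughly the number of
  steps by which the second orbit is ahead of the first. If \<open>y \<mapsto> y + g(y)\<close> were the time-one map of a
  flow, this number would be nearly constant along the orbits.
\<close>

definition scaled_offset :: "'i \<Rightarrow> nat \<Rightarrow> real" where
  "scaled_offset i j = offset i j / d i j"

definition offset_err :: "'i \<Rightarrow> nat \<Rightarrow> real" where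
  "offset_err i j = (step_err zt i j - step_err z i j) / d i j"

lemma offset_err_bigo: "j < k \<Longrightarrow> (\<lambda>i. offset_err i j) \<in> O[F](\<lambda>i. \<eta> i * \<delta> i ^ (k - 1))"
  unfolding offset_err_def by (rule divide_gap) (auto intro!: sum_in_bigo step_err_z step_err_zt)

lemma offset_eq: "d i j \<noteq> 0 \<Longrightarrow> offset i j = scaled_offset i j * d i j"
  by (simp add: scaled_offset_def)

lemma offset_Suc:
  assumes "d i j \<noteq> 0"
  shows "offset i (Suc j) =
    offset i j + d i j * (scaled_offset i j * slope z zt i j + offset_err i j)"
proof -
  have "offset i (Suc j) - offset i j = (\<Sum>l<k. a l i * zt i j ^ l) - (\<Sum>l<k. a l i * z i j ^ l)
     + (step_err zt i j - step_err z i j)"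
    by (simp add: offset_def step_err_def)
  also have "\<dots> = offset i j * slope z zt i j + (step_err zt i j - step_err z i j)"
    unfolding slope_eq by (simp add: offset_def)
  finally show ?thesis
    using assms by (simp add: scaled_offset_def offset_err_def distrib_left)
qed

lemma rel_diff_offset:
  "d i j \<noteq> 0 \<Longrightarrow> \<Delta> offset i j = scaled_offset i j * slope z zt i j + offset_err i j"
  by (simp add: rel_diff_def offset_Suc)

text \<open>
  The heart of the matter. The displacement and the gap are multiplied in each step by \<open>1 + g[z, zt]\<close>
  and by \<open>1 + g[z, z + d]\<close>, so their quotient \<open>v\<close> changes by the difference of two slopes, and
  \<open>g[z, zt] - g[z, z + d] = (v - 1) d g[z, z + d, zt]\<close> contains the factor \<open>d\<close> that \<open>\<Delta>\<close> divides by. On the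
  right-hand side only Taylor remainders are still divided by a gap, so each order of control of \<open>v\<close>
  yields the next.
\<close>

lemma rel_diff_scaled_offset:
  assumes "d i j \<noteq> 0" "d i (Suc j) \<noteq> 0"
  shows "\<Delta> scaled_offset i j = inverse (1 + \<Delta> d i j) *
    (scaled_offset i j * ((scaled_offset i j - 1) * curvature z next_z zt i j - gap_err i j / d i j)
      + offset_err i j / d i j)"
proof -
  define s where "s = \<Delta> d i j"
  define G where "G = slope z zt i j"
  have d_Suc: "d i (Suc j) = d i j * (1 + s)"
    using assms(1) by (simp add: s_def rel_diff_def field_simps)
  with assms have s: "1 + s \<noteq> 0" by auto
  have "G - slope z next_z i j = (zt i j - next_z i j) * curvature z next_z zt i j"
    unfolding G_def by (rule curvature_eq)
  moreover have "zt i j - next_z i j = (scaled_offset i j - 1) * d i j"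
    using offset_eq[OF assms(1)] by (simp add: offset_def next_z_def algebra_simps)
  moreover have "s = slope z next_z i j + gap_err i j"
    unfolding s_def using assms(1) by (rule rel_diff_gap)
  ultimately have G: "G - s =
    (scaled_offset i j - 1) * d i j * curvature z next_z zt i j - gap_err i j"
    by simp
  have "scaled_offset i (Suc j) =
    d i j * (scaled_offset i j + scaled_offset i j * G + offset_err i j) / (d i j * (1 + s))"
    using offset_Suc[OF assms(1)] offset_eq[OF assms(1)]
    by (simp add: scaled_offset_def[of i "Suc j"] d_Suc G_def algebra_simps)
  also have "\<dots> = (scaled_offset i j + scaled_offset i j * G + offset_err i j) / (1 + s)"
    using assms(1) by simp
  also have "\<dots> - scaled_offset i j = (scaled_offset i j * (G - s) + offset_err i j) / (1 + s)"
    using s by (simp add: field_simps)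
  finally have "\<Delta> scaled_offset i j = (scaled_offset i j * (G - s) + offset_err i j) / (1 + s) / d i j"
    by (simp add: rel_diff_def)
  also have "\<dots> = inverse (1 + s) * (scaled_offset i j * ((G - s) / d i j) + offset_err i j / d i j)"
    using assms(1) s by (simp add: field_simps)
  also have "(G - s) / d i j =
    (scaled_offset i j - 1) * curvature z next_z zt i j - gap_err i j / d i j"
    unfolding G using assms(1) by (simp add: field_simps)
  finally show ?thesis by (simp add: s_def)
qed

lemma bdiff_zt_if_scaled_offset:
  assumes "m < k" "bdiff m (\<lambda>_. 1) scaled_offset"
  shows "bdiff m (\<lambda>_. 1) zt"
proof (rule bdiff_cong)
  show "bdiff m (\<lambda>_. 1) (\<lambda>i j. z i j + scaled_offset i j * d i j)"
    using assms by (intro bdiff_add bdiff_mult_1 bdiff_z bdiff_gap_1) auto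
  show "\<forall>\<^sub>F i in F. \<forall>j\<le>m. zt i j = z i j + scaled_offset i j * d i j"
    using gaps_nonzero[of k] assms(1) by (auto elim!: eventually_mono simp: scaled_offset_def offset_def)
qed

text \<open>
  At order \<open>0\<close> this says that the orbits start a bounded number of steps apart. The remainders have been
  divided twice by the gaps, so \<open>k - 2\<close> further divisions are affordable, which is exactly what
  \<open>m < k\<close> asks for after one application of \<open>\<Delta>\<close>.
\<close>

lemma bdiff_scaled_offset: "m < k \<Longrightarrow> bdiff m (\<lambda>_. 1) scaled_offset"
proof (induction m)
  case 0
  have "(\<lambda>i. (zt i 0 - z i 0) * (1 / d i 0)) \<in> O[F](\<lambda>i. \<delta> i * (1 / \<delta> i))"
    using 0 by (intro landau_o.big.mult sum_in_bigo z_bigo zt_bigo gap_inverse) auto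
  also have "(\<lambda>i. \<delta> i * (1 / \<delta> i)) \<in> O[F](\<lambda>_. 1)"
    by (rule bigoI[of _ 1]) (use \<delta>_nonzero in eventually_elim, simp)
  finally show ?case by (simp add: bdiff_0 scaled_offset_def offset_def)
next
  case (Suc m)
  then have m: "m < k" "m \<le> k" "m - 1 < k" "m \<le> k - 2" by auto
  have v: "bdiff m (\<lambda>_. 1) scaled_offset" using Suc by simp
  have zt: "bdiff m (\<lambda>_. 1) zt" using m(1) v by (rule bdiff_zt_if_scaled_offset)
  note d = bdiff_gap_1[OF m(1)] bdiff_gap_1[OF m(3)]
  have to_1: "bdiff m (\<lambda>_. 1) x" if "bdiff m \<eta> x" for x
    using that \<eta>_bigo_1 by (auto intro: bdiff_mono)
  have "bdiff m \<eta> (curvature z next_z zt)"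
    using zt d m by (intro bdiff_curvature bdiff_z bdiff_next_z)
  moreover have "bdiff m \<eta> (\<lambda>i j. e i j / d i j)"
    if "\<And>j. Suc j < k \<Longrightarrow> (\<lambda>i. e i j) \<in> O[F](\<lambda>i. \<eta> i * \<delta> i ^ (k - 1))" for e
  proof (rule bdiff_error)
    fix j assume j: "j \<le> m"
    have "(\<lambda>i. e i j / d i j) \<in> O[F](\<lambda>i. \<eta> i * \<delta> i ^ (k - 1 - 1))"
      using that[of j] j Suc.prems by (intro divide_gap) auto
    then show "(\<lambda>i. e i j / d i j) \<in> O[F](\<lambda>i. \<eta> i * \<delta> i ^ m)"
      using m \<delta>_power_mono[of m "k - 1 - 1"] by (auto intro: landau_o.big_trans)
  qed (use m in auto)
  then have "bdiff m \<eta> (\<lambda>i j. gap_err i j / d i j)" "bdiff m \<eta> (\<lambda>i j. offset_err i j / d i j)"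
    using gap_err_bigo offset_err_bigo Suc_lessD by blast+
  moreover have "bdiff m (\<lambda>_. 1) (\<lambda>i j. inverse (1 + \<Delta> d i j))"
  proof (rule bdiff_inverse)
    show "bdiff m \<eta> (\<Delta> d)" using bdiff_gap[OF Suc.prems] by (simp add: bdiff_Suc)
    show "\<forall>\<^sub>F i in F. \<forall>j\<le>m. 1 + \<Delta> d i j \<noteq> 0"
      using gaps_nonzero[of k, OF order_refl]
    proof eventually_elim
      case (elim i)
      show ?case
      proof (intro allI impI)
        fix j assume "j \<le> m"
        then have "d i j \<noteq> 0" "d i (Suc j) \<noteq> 0" using elim Suc.prems by auto
        then show "1 + \<Delta> d i j \<noteq> 0" by (simp add: rel_diff_def field_simps)
      qed
    qed
  qed (use d m gaps_nonzero \<eta>_tendsto in auto)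
  ultimately have "bdiff m (\<lambda>_. 1) (\<lambda>i j. inverse (1 + \<Delta> d i j) *
    (scaled_offset i j * ((scaled_offset i j - 1) * curvature z next_z zt i j - gap_err i j / d i j)
      + offset_err i j / d i j))"
    using v d
    by (auto intro!: bdiff_mult_1 bdiff_add bdiff_diff bdiff_const dest!: to_1)
  then have "bdiff m (\<lambda>_. 1) (\<Delta> scaled_offset)"
  proof (rule bdiff_cong)
    show "\<forall>\<^sub>F i in F. \<forall>j\<le>m. \<Delta> scaled_offset i j = inverse (1 + \<Delta> d i j) *
    (scaled_offset i j * ((scaled_offset i j - 1) * curvature z next_z zt i j - gap_err i j / d i j)
      + offset_err i j / d i j)"
      using gaps_nonzero[of k, OF order_refl]
      by eventually_elim (intro allI impI rel_diff_scaled_offset; use Suc.prems in auto)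
  qed
  moreover have "bdiff 0 (\<lambda>_. 1) scaled_offset" using v by (auto intro: bdiff_order)
  ultimately show ?case by (simp add: bdiff_Suc bdiff_0)
qed

text \<open>
  Since \<open>\<Delta>w = v g[z, zt]\<close> up to remainders, the displacement \<open>w\<close> is controlled to one order more than \<open>v\<close>
  and inherits the size \<open>\<eta>\<close> of the slope.
\<close>

lemma bdiff_offset: "bdiff k \<eta> offset"
proof -
  have "(\<lambda>i. offset i 0) \<in> O[F](\<delta>)"
    unfolding offset_def by (intro sum_in_bigo z_bigo zt_bigo) auto
  then have w0: "(\<lambda>i. offset i 0) \<in> O[F](\<eta>)" using \<delta>_le by (rule landau_o.big_trans)
  show ?thesis
  proof (cases k)
    case 0
    with w0 show ?thesis by (simp add: bdiff_0)
  next
    case (Suc n)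
    then have n: "n < k" "n \<le> k" "n - 1 < k" by auto
    have "bdiff n \<eta> (\<lambda>i j. scaled_offset i j * slope z zt i j + offset_err i j)"
    proof (intro bdiff_add bdiff_mult_1 bdiff_slope bdiff_scaled_offset bdiff_zt_if_scaled_offset bdiff_z bdiff_gap_1 n)
      show "bdiff n \<eta> offset_err"
        by (rule bdiff_error) (use Suc offset_err_bigo in auto)
    qed
    then have "bdiff n \<eta> (\<Delta> offset)"
      by (rule bdiff_cong)
         (use gaps_nonzero[of k] Suc in \<open>auto elim!: eventually_mono simp: rel_diff_offset\<close>)
    with w0 show ?thesis by (simp add: Suc bdiff_Suc)
  qed
qed

lemma bdiff_zt: "bdiff k (\<lambda>_. 1) zt"
proof -
  have "bdiff k (\<lambda>_. 1) (\<lambda>i j. z i j + offset i j)"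
    using bdiff_offset \<eta>_bigo_1 by (intro bdiff_add bdiff_z) (auto intro: bdiff_mono)
  then show ?thesis by (simp add: offset_def)
qed

lemma bdiff_gap_pred: "bdiff (k - 1) (\<lambda>_. 1) d" if "k \<ge> 1"
  using that by (intro bdiff_gap_1) auto

text \<open>
  The values \<open>y\<close> are a polynomial in \<open>zt\<close>, up to a negligible error; moving its argument from \<open>zt\<close> to \<open>z\<close>
  costs a multiple of the displacement.
\<close>

lemma bdiff_values:
  assumes "k \<ge> 1" "\<And>l. l \<le> k \<Longrightarrow> b l \<in> O[F](\<lambda>_. 1)"
    and y: "\<And>j. j \<le> k \<Longrightarrow> (\<lambda>i. y i j - (\<Sum>l\<le>k. b l i * zt i j ^ l)) \<in> O[F](\<lambda>i. \<eta> i * \<delta> i ^ k)"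
  shows "bdiff k \<eta> (\<lambda>i j. y i j - (\<Sum>l\<le>k. b l i * z i j ^ l))"
proof -
  have "bdiff k \<eta> (\<lambda>i j. (y i j - (\<Sum>l\<le>k. b l i * zt i j ^ l))
      + (\<Sum>l\<le>k. b l i * ((\<Sum>p<l. z i j ^ (l - Suc p) * zt i j ^ p) * offset i j)))"
  proof (rule bdiff_add)
    show "bdiff k \<eta> (\<lambda>i j. y i j - (\<Sum>l\<le>k. b l i * zt i j ^ l))"
      using y by (intro bdiff_error) auto
    show "bdiff k \<eta> (\<lambda>i j. \<Sum>l\<le>k. b l i * ((\<Sum>p<l. z i j ^ (l - Suc p) * zt i j ^ p) * offset i j))"
      using assms(1,2) bdiff_gap_pred bdiff_zt bdiff_offset
      by (intro bdiff_sum bdiff_mult_1 bdiff_const bdiff_power bdiff_z) auto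
  qed
  also have "(\<lambda>i j. (y i j - (\<Sum>l\<le>k. b l i * zt i j ^ l))
      + (\<Sum>l\<le>k. b l i * ((\<Sum>p<l. z i j ^ (l - Suc p) * zt i j ^ p) * offset i j)))
    = (\<lambda>i j. y i j - (\<Sum>l\<le>k. b l i * z i j ^ l))"
  proof (intro ext)
    fix i j
    have "(\<Sum>p<l. z i j ^ (l - Suc p) * zt i j ^ p) * offset i j = zt i j ^ l - z i j ^ l" for l
      by (simp add: power_diff_sumr2[of "zt i j"] offset_def)
    then show "(y i j - (\<Sum>l\<le>k. b l i * zt i j ^ l))
      + (\<Sum>l\<le>k. b l i * ((\<Sum>p<l. z i j ^ (l - Suc p) * zt i j ^ p) * offset i j))
      = y i j - (\<Sum>l\<le>k. b l i * z i j ^ l)"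
      by (simp add: right_diff_distrib sum_subtractf)
  qed
  finally show ?thesis .
qed

section \<open>Polynomials with small differences\<close>

text \<open>
  The deviation of \<open>\<Delta>\<close> from the derivative on the sequence \<open>z\<^sup>n\<close>. Every term of it contains a gap, and the
  gaps have differences of size \<open>\<eta>\<close>.
\<close>

definition power_err :: "nat \<Rightarrow> 'i \<Rightarrow> nat \<Rightarrow> real" where
  "power_err n i j = \<Delta> (\<lambda>i j. z i j ^ n) i j - of_nat n * z i j ^ (n - 1)"

lemma power_err_Suc:
  assumes "d i j \<noteq> 0"
  shows "power_err (Suc n) i j =
    z i j * power_err n i j + power_err n i j * d i j + (of_nat n * z i j ^ (n - 1)) * d i j"
proof -
  define D where "D = \<Delta> (\<lambda>i j. z i j ^ n) i j"
  have z_Suc: "z i (Suc j) = z i j + d i j" by (simp add: d_def)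
  have pow: "z i (Suc j) ^ n = z i j ^ n + d i j * D"
    using assms by (simp add: D_def rel_diff_def)
  have "\<Delta> (\<lambda>i j. z i j ^ Suc n) i j = (z i (Suc j) * z i (Suc j) ^ n - z i j * z i j ^ n) / d i j"
    by (simp add: rel_diff_def)
  also have "\<dots> = (d i j * (z i j ^ n + z i j * D + d i j * D)) / d i j"
    unfolding pow unfolding z_Suc by (simp add: algebra_simps)
  also have "\<dots> = z i j ^ n + z i j * D + d i j * D"
    using assms by simp
  finally show ?thesis
    by (cases n) (simp_all add: power_err_def D_def algebra_simps)
qed

lemma bdiff_power_err:
  assumes "k \<ge> 1"
  shows "bdiff (k - 1) \<eta> (power_err n)"
proof (induction n)
  case 0
  have "power_err 0 = (\<lambda>i j. 0)" by (simp add: power_err_def rel_diff_def fun_eq_iff)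
  then show ?case by (simp add: bdiff_const)
next
  case (Suc n)
  have k: "k - 1 < k" "k - 1 - 1 < k" "k - 1 \<le> k" using assms by auto
  have "bdiff (k - 1) \<eta> (\<lambda>i j. z i j * power_err n i j + d i j * power_err n i j
    + (of_nat n * z i j ^ (n - 1)) * d i j)"
    using Suc k
    by (intro bdiff_add bdiff_mult_1 bdiff_const bdiff_power bdiff_z bdiff_gap bdiff_gap_1) auto
  then show ?case
    by (rule bdiff_cong)
       (use gaps_nonzero[of k] assms in \<open>auto elim!: eventually_mono simp: power_err_Suc\<close>)
qed

lemma rel_diff_funpow_add:
  "(rel_diff e ^^ r) (\<lambda>j. x j + y j) = (\<lambda>j. (rel_diff e ^^ r) x j + (rel_diff e ^^ r) y j)"
  by (induction r) (simp_all add: rel_diff_def fun_eq_iff diff_divide_distrib add_divide_distrib)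

lemma rel_diff_funpow_cmult:
  "(rel_diff e ^^ r) (\<lambda>j. c * x j) = (\<lambda>j. c * (rel_diff e ^^ r) x j)"
  by (induction r) (simp_all add: rel_diff_def fun_eq_iff right_diff_distrib)

lemma rel_diff_funpow_sum:
  "finite A \<Longrightarrow> (rel_diff e ^^ r) (\<lambda>j. \<Sum>n\<in>A. x n j) = (\<lambda>j. \<Sum>n\<in>A. (rel_diff e ^^ r) (x n) j)"
proof (induction A rule: finite_induct)
  case empty
  show ?case using rel_diff_funpow_cmult[of r e 0 "\<lambda>_. 0"] by simp
qed (simp add: rel_diff_funpow_add)

definition power_diff :: "nat \<Rightarrow> nat \<Rightarrow> 'i \<Rightarrow> real" where
  "power_diff r n i = (rel_diff (d i) ^^ r) (\<lambda>j. z i j ^ n) 0"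

lemma power_diff_bigo:
  assumes "r \<le> k"
  shows "(\<lambda>i. power_diff r n i - (if r = n then fact n else 0)) \<in> O[F](\<eta>)"
  using assms
proof (induction r arbitrary: n)
  case 0
  show ?case by (simp add: power_diff_def z_start power_0_left)
next
  case (Suc r)
  have "(\<lambda>i. (rel_diff (d i) ^^ r) (power_err n i) 0) \<in> O[F](\<eta>)"
    using bdiff_power_err[of n] Suc.prems by (auto simp: bdiff_def)
  moreover have "(\<lambda>i. of_nat n * (power_diff r (n - 1) i - (if r = n - 1 then fact (n - 1) else 0)))
    \<in> O[F](\<eta>)"
  proof -
    have "(\<lambda>i. of_nat n * (power_diff r (n - 1) i - (if r = n - 1 then fact (n - 1) else 0)))
      \<in> O[F](\<lambda>i. 1 * \<eta> i)"
      by (intro landau_o.big.mult bigo_const Suc.IH) (use Suc.prems in simp)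
    then show ?thesis by (simp only: mult_1)
  qed
  ultimately have "(\<lambda>i. of_nat n * (power_diff r (n - 1) i - (if r = n - 1 then fact (n - 1) else 0))
     + (rel_diff (d i) ^^ r) (power_err n i) 0) \<in> O[F](\<eta>)"
    by (intro sum_in_bigo)
  also have "(\<lambda>i. of_nat n * (power_diff r (n - 1) i - (if r = n - 1 then fact (n - 1) else 0))
     + (rel_diff (d i) ^^ r) (power_err n i) 0)
    = (\<lambda>i. power_diff (Suc r) n i - (if Suc r = n then fact n else 0))"
  proof
    fix i
    have "rel_diff (d i) (\<lambda>j. z i j ^ n) = (\<lambda>j. of_nat n * z i j ^ (n - 1) + power_err n i j)"
      by (simp add: power_err_def fun_eq_iff)
    then have "power_diff (Suc r) n i
      = of_nat n * power_diff r (n - 1) i + (rel_diff (d i) ^^ r) (power_err n i) 0"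
      by (simp add: power_diff_def funpow_Suc_right rel_diff_funpow_add rel_diff_funpow_cmult
          del: funpow.simps)
    then show "of_nat n * (power_diff r (n - 1) i - (if r = n - 1 then fact (n - 1) else 0))
     + (rel_diff (d i) ^^ r) (power_err n i) 0
     = power_diff (Suc r) n i - (if Suc r = n then fact n else 0)"
      by (cases n) (auto simp: algebra_simps)
  qed
  finally show ?case .
qed

text \<open>
  The matrix that maps the coefficients of a polynomial in \<open>z\<close> to its iterated differences at index \<open>0\<close> is
  diagonal with entries \<open>r!\<close> up to \<open>O(\<eta>)\<close>, hence boundedly invertible once \<open>\<eta>\<close> is small. This is the
  passage from iterated relative differences to interpolation polynomials.
\<close>

lemma coefficients_bigo:
  assumes c: "bdiff k \<eta> (\<lambda>i j. \<Sum>n\<le>k. c n i * z i j ^ n)" and "n \<le> k"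
  shows "c n \<in> O[F](\<eta>)"
proof -
  define T where "T r i = (rel_diff (d i) ^^ r) (\<lambda>j. \<Sum>n\<le>k. c n i * z i j ^ n) 0" for r i
  define e where "e r n i = power_diff r n i - (if r = n then fact n else 0)" for r n i
  define S where "S i = (\<Sum>r\<le>k. \<bar>c r i\<bar>)" for i
  define E where "E i = (\<Sum>r\<le>k. \<Sum>n\<le>k. \<bar>e r n i\<bar>)" for i
  have T_bigo: "(\<lambda>i. \<Sum>r\<le>k. \<bar>T r i\<bar>) \<in> O[F](\<eta>)"
    by (rule big_sum_in_bigo) (use c in \<open>auto simp: T_def bdiff_def\<close>)
  have "E \<in> O[F](\<eta>)"
    unfolding E_def e_def
    by (intro big_sum_in_bigo landau_o.big.abs_in_iff[THEN iffD2] power_diff_bigo) simp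
  also have "\<eta> \<in> o[F](\<lambda>_. 1)" using \<eta>_tendsto by (intro smalloI_tendsto) auto
  finally have "(E \<longlongrightarrow> 0) F" by (auto dest: smalloD_tendsto)
  then have E_small: "\<forall>\<^sub>F i in F. E i < 1 / 2"
    by (rule order_tendstoD) auto
  have T: "T r i = fact r * c r i + (\<Sum>n\<le>k. c n i * e r n i)" if "r \<le> k" for r i
  proof -
    have "T r i = (\<Sum>n\<le>k. c n i * power_diff r n i)"
      by (simp add: T_def rel_diff_funpow_sum rel_diff_funpow_cmult power_diff_def)
    also have "\<dots> = (\<Sum>n\<le>k. (if r = n then fact n * c n i else 0) + c n i * e r n i)"
      by (rule sum.cong) (auto simp: e_def algebra_simps)
    also have "\<dots> = fact r * c r i + (\<Sum>n\<le>k. c n i * e r n i)"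
      using that by (simp add: sum.distrib)
    finally show ?thesis .
  qed
  \<comment> \<open>Diagonal dominance: the off-diagonal part is absorbed because \<open>E\<close> tends to \<open>0\<close>.\<close>
  have S_le: "S i \<le> (\<Sum>r\<le>k. \<bar>T r i\<bar>) + S i * E i" for i
  proof -
    have "\<bar>c r i\<bar> \<le> \<bar>T r i\<bar> + S i * (\<Sum>n\<le>k. \<bar>e r n i\<bar>)" if "r \<le> k" for r
    proof -
      have "\<bar>c r i\<bar> \<le> fact r * \<bar>c r i\<bar>"
        using mult_right_mono[of 1 "fact r" "\<bar>c r i\<bar>"] by simp
      also have "\<dots> = \<bar>T r i - (\<Sum>n\<le>k. c n i * e r n i)\<bar>"
        using T[OF that, of i] by (simp add: abs_mult)
      also have "\<dots> \<le> \<bar>T r i\<bar> + (\<Sum>n\<le>k. \<bar>c n i * e r n i\<bar>)"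
        using sum_abs[of "\<lambda>n. c n i * e r n i" "{..k}"] by linarith
      also have "(\<Sum>n\<le>k. \<bar>c n i * e r n i\<bar>) \<le> (\<Sum>n\<le>k. S i * \<bar>e r n i\<bar>)"
        unfolding abs_mult S_def
        by (intro sum_mono mult_right_mono member_le_sum) auto
      finally show ?thesis by (simp add: sum_distrib_left)
    qed
    then have "S i \<le> (\<Sum>r\<le>k. \<bar>T r i\<bar> + S i * (\<Sum>n\<le>k. \<bar>e r n i\<bar>))"
      unfolding S_def by (intro sum_mono) auto
    then show ?thesis by (simp add: sum.distrib E_def sum_distrib_left)
  qed
  have bound: "\<forall>\<^sub>F i in F. \<bar>c n i\<bar> \<le> 2 * (\<Sum>r\<le>k. \<bar>T r i\<bar>)"
    using E_small
  proof (eventually_elim)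
    case (elim i)
    have "0 \<le> S i" unfolding S_def by (intro sum_nonneg) auto
    then have "S i * E i \<le> S i * (1 / 2)" using elim by (intro mult_left_mono) auto
    moreover have "\<bar>c n i\<bar> \<le> S i" unfolding S_def using \<open>n \<le> k\<close> by (intro member_le_sum) auto
    ultimately show ?case using S_le[of i] by linarith
  qed
  have "c n \<in> O[F](\<lambda>i. \<Sum>r\<le>k. \<bar>T r i\<bar>)"
    by (rule bigoI[of _ 2]) (use bound in eventually_elim, auto)
  then show ?thesis using T_bigo by (rule landau_o.big_trans)
qed

text \<open>
  On the nodes, the interpolation polynomial differs from \<open>\<Sum>l\<le>k. b l z\<^sup>l\<close> by a polynomial of degree at most
  \<open>k\<close> with small iterated differences, which therefore has small coefficients.
\<close>

theorem interpolation_leading_coefficient: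
  assumes "k \<ge> 1" "\<And>l. l \<le> k \<Longrightarrow> b l \<in> O[F](\<lambda>_. 1)"
    and y: "\<And>j. j \<le> k \<Longrightarrow> (\<lambda>i. y i j - (\<Sum>l\<le>k. b l i * zt i j ^ l)) \<in> O[F](\<lambda>i. \<eta> i * \<delta> i ^ k)"
    and P: "\<forall>\<^sub>F i in F. degree (P i) \<le> k \<and> (\<forall>j\<le>k. poly (P i) (z i j) = y i j)"
  shows "(\<lambda>i. coeff (P i) k - b k i) \<in> O[F](\<eta>)"
proof -
  have "bdiff k \<eta> (\<lambda>i j. \<Sum>n\<le>k. (coeff (P i) n - b n i) * z i j ^ n)"
  proof (rule bdiff_cong[OF bdiff_values[OF assms(1,2) y]])
    show "\<forall>\<^sub>F i in F. \<forall>j\<le>k. (\<Sum>n\<le>k. (coeff (P i) n - b n i) * z i j ^ n)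
        = y i j - (\<Sum>l\<le>k. b l i * z i j ^ l)"
      using P
    proof eventually_elim
      case (elim i)
      show ?case
      proof (intro allI impI)
        fix j assume "j \<le> k"
        have "y i j = poly (P i) (z i j)" using elim \<open>j \<le> k\<close> by simp
        also have "\<dots> = (\<Sum>n\<le>k. coeff (P i) n * z i j ^ n)"
          unfolding poly_altdef using elim
          by (intro sum.mono_neutral_left) (auto simp: coeff_eq_0)
        finally show "(\<Sum>n\<le>k. (coeff (P i) n - b n i) * z i j ^ n)
          = y i j - (\<Sum>l\<le>k. b l i * z i j ^ l)"
          by (simp add: left_diff_distrib sum_subtractf)
      qed
    qed
  qed
  then show ?thesis by (rule coefficients_bigo) simp
qed

end

section \<open>Functions of class C^r on an interval\<close>

lemma nderiv_on_has_derivative: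
  assumes "C_on r S g" "s < r" "x \<in> S"
  shows "(nderiv_on s S g has_real_derivative nderiv_on (Suc s) S g x) (at x within S)"
proof -
  have "nderiv_on s S g differentiable at x within S"
    using assms by (simp add: C_on_def differentiable_on_def)
  then show ?thesis
    by (simp only: has_real_derivative_iff_has_vector_derivative vector_derivative_works nderiv_on.simps)
qed

lemma C_on_mono: "C_on r S g \<Longrightarrow> s \<le> r \<Longrightarrow> C_on s S g"
  by (cases "s = r") (auto simp: C_on_def intro: differentiable_imp_continuous_on)

text \<open>
  Derivatives within a nondegenerate interval are unique, so a recursively given chain of derivatives
  determines the iterated derivative on the whole interval, end points included.
\<close>

lemma nderiv_on_unique:
  assumes "a < b" and D0: "\<And>x. x \<in> {a..b} \<Longrightarrow> D 0 x = g x"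
    and D: "\<And>s x. s < r \<Longrightarrow> x \<in> {a..b} \<Longrightarrow>
      (D s has_real_derivative D (Suc s) x) (at x within {a..b})"
    and "s \<le> r" "x \<in> {a..b}"
  shows "nderiv_on s {a..b} g x = D s x"
  using assms(4,5)
proof (induction s arbitrary: x)
  case 0
  then show ?case using D0 by simp
next
  case (Suc s)
  have "(nderiv_on s {a..b} g has_vector_derivative D (Suc s) x) (at x within {a..b})"
  proof (rule has_vector_derivative_transform)
    show "(D s has_vector_derivative D (Suc s) x) (at x within {a..b})"
      using D Suc.prems by (simp flip: has_real_derivative_iff_has_vector_derivative)
  qed (use Suc in auto)
  then show ?case
    using vector_derivative_within_closed_interval[OF assms(1)] Suc.prems by auto
qed

lemma differentiable_on_transform:
  fixes f g :: "real \<Rightarrow> real"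
  assumes "f differentiable_on S" "\<And>x. x \<in> S \<Longrightarrow> g x = f x"
  shows "g differentiable_on S"
  unfolding differentiable_on_def
proof
  fix x assume "x \<in> S"
  then have "f differentiable at x within S"
    using assms(1) by (simp add: differentiable_on_def)
  then show "g differentiable at x within S"
    by (rule differentiable_transform_within[where d = 1]) (use \<open>x \<in> S\<close> assms(2) in auto)
qed

lemma C_on_diff:
  assumes "a < b" "C_on r {a..b} f" "C_on r {a..b} g"
  shows "s \<le> r \<Longrightarrow> x \<in> {a..b} \<Longrightarrow>
      nderiv_on s {a..b} (\<lambda>x. f x - g x) x = nderiv_on s {a..b} f x - nderiv_on s {a..b} g x"
    and "C_on r {a..b} (\<lambda>x. f x - g x)"
proof -
  let ?D = "\<lambda>s x. nderiv_on s {a..b} f x - nderiv_on s {a..b} g x"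
  have D: "(?D s has_real_derivative ?D (Suc s) x) (at x within {a..b})"
    if "s < r" "x \<in> {a..b}" for s x
    using that assms nderiv_on_has_derivative by (intro derivative_intros) blast+
  show eq: "nderiv_on s {a..b} (\<lambda>x. f x - g x) x = ?D s x" if "s \<le> r" "x \<in> {a..b}" for s x
    by (rule nderiv_on_unique[where r = r]) (use assms(1) D that in auto)
  have "nderiv_on s {a..b} (\<lambda>x. f x - g x) differentiable_on {a..b}" if "s < r" for s
  proof -
    have "?D s differentiable_on {a..b}" using assms that by (simp add: C_on_def)
    then show ?thesis
      by (rule differentiable_on_transform) (use eq that in simp)
  qed
  moreover have "continuous_on {a..b} (nderiv_on r {a..b} (\<lambda>x. f x - g x))"
  proof (rule continuous_on_eq)
    show "continuous_on {a..b} (?D r)" using assms by (simp add: C_on_def continuous_on_diff)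
  qed (simp add: eq)
  ultimately show "C_on r {a..b} (\<lambda>x. f x - g x)" by (simp add: C_on_def)
qed

lemma C_on_ident:
  fixes a b :: real
  assumes "a < b"
  shows "C_on r {a..b} (\<lambda>x. x)"
proof -
  define D :: "nat \<Rightarrow> real \<Rightarrow> real" where
    "D s x = (if s = 0 then x else if s = 1 then 1 else 0)" for s x
  have D: "(D s has_real_derivative D (Suc s) x) (at x within {a..b})" for s x
    by (cases "s = 0"; cases "s = 1") (auto simp: D_def[abs_def])
  have eq: "nderiv_on s {a..b} (\<lambda>x. x) x = D s x" if "x \<in> {a..b}" for s x
    by (rule nderiv_on_unique[where r = s, OF assms]) (use D that in \<open>auto simp: D_def\<close>)
  have "nderiv_on s {a..b} (\<lambda>x. x) differentiable_on {a..b}" for s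
  proof (rule differentiable_on_transform)
    show "D s differentiable_on {a..b}"
      unfolding differentiable_on_def
      using D field_differentiable_def field_differentiable_imp_differentiable by blast
  qed (use eq in simp)
  then show ?thesis by (simp add: C_on_def differentiable_imp_continuous_on)
qed

lemma nderiv_on_le_C_norm:
  assumes "C_on r {a..b} g" "s \<le> r" "x \<in> {a..b}"
  shows "\<bar>nderiv_on s {a..b} g x\<bar> \<le> C_norm r {a..b} g"
proof -
  have "continuous_on {a..b} (nderiv_on s {a..b} g)"
    using C_on_mono[OF assms(1,2)] by (simp add: C_on_def)
  then have "compact ((\<lambda>x. \<bar>nderiv_on s {a..b} g x\<bar>) ` {a..b})"
    by (intro compact_continuous_image continuous_intros) auto
  then have "\<bar>nderiv_on s {a..b} g x\<bar> \<le> (SUP x\<in>{a..b}. \<bar>nderiv_on s {a..b} g x\<bar>)"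
    using assms(3) by (intro cSUP_upper compact_imp_bounded bounded_imp_bdd_above)
  also have "\<dots> \<le> C_norm r {a..b} g"
    unfolding C_norm_def using assms(2) by (intro Max_ge) auto
  finally show ?thesis .
qed

text \<open>
  The points are interior, where derivatives within the interval are ordinary derivatives and the
  Maclaurin formula applies; the factorial in the remainder is dropped.
\<close>

lemma taylor_at_0:
  assumes "C_on r {-\<epsilon>..\<epsilon>} g" "\<bar>x\<bar> < \<epsilon>"
  shows "\<bar>g x - (\<Sum>l<r. nderiv_on l {-\<epsilon>..\<epsilon>} g 0 / fact l * x ^ l)\<bar>
    \<le> C_norm r {-\<epsilon>..\<epsilon>} g * \<bar>x\<bar> ^ r"
proof -
  let ?D = "\<lambda>l. nderiv_on l {-\<epsilon>..\<epsilon>} g"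
  have "DERIV (?D m) t :> ?D (Suc m) t" if "m < r" "\<bar>t\<bar> \<le> \<bar>x\<bar>" for m t
  proof -
    have t: "- \<epsilon> < t" "t < \<epsilon>" using that assms(2) by auto
    with nderiv_on_has_derivative[OF assms(1) that(1), of t]
    show ?thesis by (simp add: at_within_Icc_at)
  qed
  then obtain t where t: "\<bar>t\<bar> \<le> \<bar>x\<bar>"
    "g x = (\<Sum>l<r. ?D l 0 / fact l * x ^ l) + ?D r t / fact r * x ^ r"
    using Maclaurin_bi_le[of ?D g r x] by auto
  have "\<bar>?D r t / fact r * x ^ r\<bar> = \<bar>?D r t\<bar> / fact r * \<bar>x\<bar> ^ r"
    by (simp add: abs_mult power_abs)
  also have "\<dots> \<le> \<bar>?D r t\<bar> / 1 * \<bar>x\<bar> ^ r"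
    by (intro mult_right_mono divide_left_mono) auto
  also have "\<dots> \<le> C_norm r {-\<epsilon>..\<epsilon>} g * \<bar>x\<bar> ^ r"
  proof (intro mult_right_mono)
    have "t \<in> {-\<epsilon>..\<epsilon>}" using t(1) assms(2) by auto
    then show "\<bar>?D r t\<bar> / 1 \<le> C_norm r {-\<epsilon>..\<epsilon>} g"
      using nderiv_on_le_C_norm[OF assms(1)] by simp
  qed simp
  finally show ?thesis using t(2) by simp
qed

section \<open>Orbits of a map close to the identity\<close>

locale near_identity =
  fixes \<epsilon> \<eta> :: real and f :: "real \<Rightarrow> real"
  assumes cont: "continuous_on {-\<epsilon>..\<epsilon>} f"
    and lipschitz: "\<And>x y. x \<in> {-\<epsilon>..\<epsilon>} \<Longrightarrow> y \<in> {-\<epsilon>..\<epsilon>} \<Longrightarrow>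
      \<bar>(f y - y) - (f x - x)\<bar> \<le> \<eta> * \<bar>y - x\<bar>"
    and close: "\<And>x. x \<in> {-\<epsilon>..\<epsilon>} \<Longrightarrow> \<bar>f x - x\<bar> \<le> \<eta>"
    and \<epsilon>_pos: "0 < \<epsilon>" and \<eta>_small: "\<eta> \<le> 1 / 2" "\<eta> \<le> \<epsilon> / 2" and f0_pos: "0 < f 0"
begin

abbreviation I :: "real set" where "I \<equiv> {-\<epsilon>..\<epsilon>}"

lemma expansion:
  assumes "x \<in> I" "y \<in> I"
  shows "\<bar>y - x\<bar> \<le> 2 * \<bar>f y - f x\<bar>" "\<bar>f y - f x\<bar> \<le> 2 * \<bar>y - x\<bar>"
proof -
  have "\<eta> * \<bar>y - x\<bar> \<le> 1 / 2 * \<bar>y - x\<bar>"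
    using \<eta>_small(1) by (intro mult_right_mono) auto
  with lipschitz[OF assms] have "\<bar>(f y - y) - (f x - x)\<bar> \<le> 1 / 2 * \<bar>y - x\<bar>"
    by linarith
  then show "\<bar>y - x\<bar> \<le> 2 * \<bar>f y - f x\<bar>" "\<bar>f y - f x\<bar> \<le> 2 * \<bar>y - x\<bar>"
    by (simp_all add: abs_if split: if_splits)
qed

lemma inj: "inj_on f I"
proof (rule inj_onI)
  fix x y assume "x \<in> I" "y \<in> I" "f x = f y"
  then show "x = y" using expansion(1)[of x y] by simp
qed

text \<open>
  Half of the interval is left to the image because the end points move by at most \<open>\<eta> \<le> \<epsilon>/2\<close>.
\<close>

lemma in_image:
  assumes "\<bar>y\<bar> \<le> \<epsilon> / 2"
  shows "y \<in> f ` I"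
proof -
  have "f (-\<epsilon>) \<le> y" "y \<le> f \<epsilon>"
    using close[of "-\<epsilon>"] close[of \<epsilon>] \<eta>_small \<epsilon>_pos assms by auto
  then obtain x where "-\<epsilon> \<le> x" "x \<le> \<epsilon>" "f x = y"
    using IVT'[of f "-\<epsilon>" y \<epsilon>] cont \<epsilon>_pos by auto
  then show ?thesis by auto
qed

lemma zero_in_I: "0 \<in> I" using \<epsilon>_pos by simp

text \<open>
  Adding \<open>2 f(0)\<close> to \<open>\<bar>x\<bar>\<close> absorbs the translation part of the map, so that the sum at most doubles
  under one step in either direction and the same iteration serves forward and backward orbits.
\<close>

lemma forward_step: "x \<in> I \<Longrightarrow> \<bar>f x\<bar> + 2 * f 0 \<le> 2 * (\<bar>x\<bar> + 2 * f 0)"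
  using expansion(2)[OF zero_in_I, of x] f0_pos by auto

lemma backward_step:
  assumes "\<bar>y\<bar> \<le> \<epsilon> / 2"
  shows "\<bar>inv_into I f y\<bar> + 2 * f 0 \<le> 2 * (\<bar>y\<bar> + 2 * f 0)"
proof -
  have "inv_into I f y \<in> I" "f (inv_into I f y) = y"
    using in_image[OF assms] by (rule inv_into_into, rule f_inv_into_f)
  then show ?thesis
    using expansion(1)[OF zero_in_I, of "inv_into I f y"] f0_pos abs_triangle_ineq4[of y "f 0"]
    by auto
qed

lemma iterate_bound:
  assumes step: "\<And>x. \<bar>x\<bar> \<le> \<epsilon> / 2 \<Longrightarrow> \<bar>g x\<bar> + 2 * f 0 \<le> 2 * (\<bar>x\<bar> + 2 * f 0)"
    and small: "2 ^ n * (\<bar>x\<bar> + 2 * f 0) \<le> \<epsilon> / 2" and "m \<le> n"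
  shows "\<bar>(g ^^ m) x\<bar> + 2 * f 0 \<le> 2 ^ m * (\<bar>x\<bar> + 2 * f 0)" "\<bar>(g ^^ m) x\<bar> < \<epsilon> / 2"
proof -
  have *: "\<bar>(g ^^ m) x\<bar> + 2 * f 0 \<le> 2 ^ m * (\<bar>x\<bar> + 2 * f 0) \<and> \<bar>(g ^^ m) x\<bar> < \<epsilon> / 2"
    using \<open>m \<le> n\<close>
  proof (induction m)
    have le: "2 ^ m * (\<bar>x\<bar> + 2 * f 0) \<le> \<epsilon> / 2" if "m \<le> n" for m :: nat
    proof -
      have "2 ^ m * (\<bar>x\<bar> + 2 * f 0) \<le> 2 ^ n * (\<bar>x\<bar> + 2 * f 0)"
        using that f0_pos by (intro mult_right_mono power_increasing) auto
      with small show ?thesis by linarith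
    qed
    {
      case 0
      then show ?case using le[of 0] f0_pos by auto
    next
      case (Suc m)
      then have "\<bar>(g ^^ Suc m) x\<bar> + 2 * f 0 \<le> 2 * (2 ^ m * (\<bar>x\<bar> + 2 * f 0))"
        using step[of "(g ^^ m) x"] by auto
      then show ?case using le[of "Suc m"] Suc.prems f0_pos by auto
    }
  qed
  then show "\<bar>(g ^^ m) x\<bar> + 2 * f 0 \<le> 2 ^ m * (\<bar>x\<bar> + 2 * f 0)" "\<bar>(g ^^ m) x\<bar> < \<epsilon> / 2"
    by auto
qed

lemma iterate_on_bound:
  assumes small: "2 ^ n * (\<bar>x\<bar> + 2 * f 0) \<le> \<epsilon> / 2" and j: "\<bar>j\<bar> \<le> int n"
  shows "iterate_defined I f j x" "\<bar>iterate_on I f j x\<bar> < \<epsilon> / 2"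
    "\<bar>iterate_on I f j x\<bar> + 2 * f 0 \<le> 2 ^ nat \<bar>j\<bar> * (\<bar>x\<bar> + 2 * f 0)"
proof -
  define g where "g = (if j \<ge> 0 then f else inv_into I f)"
  have "\<bar>g x\<bar> + 2 * f 0 \<le> 2 * (\<bar>x\<bar> + 2 * f 0)" if "\<bar>x\<bar> \<le> \<epsilon> / 2" for x
  proof -
    have "x \<in> I" using that \<epsilon>_pos by auto
    then show ?thesis using forward_step backward_step[OF that] by (simp add: g_def)
  qed
  note bound = iterate_bound[OF this small]
  have "iterate_on I f j x = (g ^^ nat \<bar>j\<bar>) x"
    by (simp add: iterate_on_def g_def)
  moreover have "nat \<bar>j\<bar> \<le> n" using j by linarith
  ultimately show "\<bar>iterate_on I f j x\<bar> < \<epsilon> / 2"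
    "\<bar>iterate_on I f j x\<bar> + 2 * f 0 \<le> 2 ^ nat \<bar>j\<bar> * (\<bar>x\<bar> + 2 * f 0)"
    using bound[of "nat \<bar>j\<bar>"] by auto
  have "\<bar>(g ^^ i) x\<bar> < \<epsilon> / 2" if "i < nat \<bar>j\<bar>" for i
    using that bound(2)[of i] j by auto
  then show "iterate_defined I f j x"
    using inj in_image \<epsilon>_pos by (force simp: iterate_defined_def g_def)
qed

lemma f0_le: "f 0 \<le> \<eta>"
  using close[OF zero_in_I] by simp

text \<open>
  The starting points allowed here are those between the iterates of \<open>0\<close> with indices \<open>-2k\<close> and \<open>2k\<close>,
  which have modulus at most \<open>2\<^sup>2\<^sup>k\<^sup>+\<^sup>1 f(0)\<close>; \<open>k\<close> more doublings give the bound.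
\<close>

lemma orbit_bound:
  assumes "2 ^ (3 * k + 3) * \<eta> \<le> \<epsilon>" "\<bar>x\<bar> \<le> 2 ^ (2 * k + 1) * f 0"
  shows "2 ^ k * (\<bar>x\<bar> + 2 * f 0) \<le> 2 ^ (3 * k + 2) * f 0"
    and "2 ^ k * (\<bar>x\<bar> + 2 * f 0) \<le> \<epsilon> / 2"
    and "j \<le> k \<Longrightarrow> \<bar>(f ^^ j) x\<bar> \<le> 2 ^ (3 * k + 2) * f 0"
    and "j \<le> k \<Longrightarrow> \<bar>(f ^^ j) x\<bar> < \<epsilon> / 2"
proof -
  have "(2::real) ^ 1 \<le> 2 ^ (2 * k + 1)" by (rule power_increasing) auto
  then have "2 * f 0 \<le> 2 ^ (2 * k + 1) * f 0"
    using f0_pos by (intro mult_right_mono) auto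
  then have "2 ^ k * (\<bar>x\<bar> + 2 * f 0) \<le> 2 ^ k * (2 * (2 ^ (2 * k + 1) * f 0))"
    using assms(2) by (intro mult_left_mono) auto
  also have "\<dots> = 2 ^ (3 * k + 2) * f 0"
  proof -
    have "3 * k + 2 = k + (1 + (2 * k + 1))" by simp
    then show ?thesis by (simp only: power_add power_one_right mult.assoc)
  qed
  finally show le: "2 ^ k * (\<bar>x\<bar> + 2 * f 0) \<le> 2 ^ (3 * k + 2) * f 0" .
  have "2 ^ (3 * k + 2) * f 0 \<le> 2 ^ (3 * k + 2) * \<eta>"
    using f0_le by (intro mult_left_mono) auto
  moreover have "2 * (2 ^ (3 * k + 2) * \<eta>) = 2 ^ (3 * k + 3) * \<eta>" by (simp add: power_add)
  ultimately show small: "2 ^ k * (\<bar>x\<bar> + 2 * f 0) \<le> \<epsilon> / 2"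
    using le assms(1) by linarith
  show "\<bar>(f ^^ j) x\<bar> < \<epsilon> / 2" if "j \<le> k"
    using iterate_on_bound(2)[OF small, of "int j"] that by (simp add: iterate_on_def)
  show "\<bar>(f ^^ j) x\<bar> \<le> 2 ^ (3 * k + 2) * f 0" if "j \<le> k"
  proof -
    have "2 ^ j * (\<bar>x\<bar> + 2 * f 0) \<le> 2 ^ k * (\<bar>x\<bar> + 2 * f 0)"
      using that f0_pos by (intro mult_right_mono power_increasing) auto
    then show ?thesis
      using iterate_on_bound(3)[OF small, of "int j"] that f0_pos le by (simp add: iterate_on_def)
  qed
qed

lemma orbit_gap:
  assumes "2 ^ (3 * k + 3) * \<eta> \<le> \<epsilon>" "2 ^ (3 * k + 3) * \<eta> \<le> 1" "j \<le> k"
  shows "f 0 \<le> 2 * ((f ^^ Suc j) 0 - (f ^^ j) 0)"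
proof -
  let ?z = "(f ^^ j) 0"
  have x: "\<bar>0\<bar> \<le> 2 ^ (2 * k + 1) * f 0" using f0_pos by simp
  have "?z \<in> I" using orbit_bound(4)[OF assms(1) x assms(3)] by auto
  then have "\<bar>(f ?z - ?z) - f 0\<bar> \<le> \<eta> * \<bar>?z\<bar>"
    using lipschitz[OF zero_in_I, of ?z] by simp
  moreover have "\<eta> * \<bar>?z\<bar> \<le> \<eta> * (2 ^ (3 * k + 2) * f 0)"
    using f0_le f0_pos orbit_bound(3)[OF assms(1) x assms(3)] by (intro mult_left_mono) auto
  moreover have "2 ^ (3 * k + 2) * \<eta> * f 0 \<le> 1 / 2 * f 0"
    using assms(2) f0_pos by (intro mult_right_mono) (auto simp: power_add)
  ultimately show ?thesis by (simp add: algebra_simps)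
qed

lemma orbit_strict_mono:
  assumes "2 ^ (3 * k + 3) * \<eta> \<le> \<epsilon>" "2 ^ (3 * k + 3) * \<eta> \<le> 1" "i < j" "j \<le> k"
  shows "(f ^^ i) 0 < (f ^^ j) 0"
  using assms(3,4)
proof (induction j)
  case (Suc j)
  have "(f ^^ j) 0 < (f ^^ Suc j) 0"
    using orbit_gap[OF assms(1,2), of j] f0_pos Suc.prems by auto
  then show ?case using Suc by (cases "i = j") auto
qed simp

end

lemma near_identity_if_C_norm:
  assumes "C_on r {-\<epsilon>..\<epsilon>} f" "C_norm r {-\<epsilon>..\<epsilon>} (\<lambda>x. f x - x) < \<eta>" "1 \<le> r"
    and "0 < \<epsilon>" "\<eta> \<le> 1 / 2" "\<eta> \<le> \<epsilon> / 2" "0 < f 0"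
  shows "near_identity \<epsilon> \<eta> f"
proof
  let ?g = "\<lambda>x. f x - x"
  have g: "C_on r {-\<epsilon>..\<epsilon>} ?g"
    using assms by (intro C_on_diff C_on_ident) auto
  have le: "\<bar>nderiv_on s {-\<epsilon>..\<epsilon>} ?g x\<bar> \<le> \<eta>" if "s \<le> r" "x \<in> {-\<epsilon>..\<epsilon>}" for s x
    using nderiv_on_le_C_norm[OF g that] assms(2) by simp
  show "\<bar>f x - x\<bar> \<le> \<eta>" if "x \<in> {-\<epsilon>..\<epsilon>}" for x
    using le[of 0 x] that by simp
  show "\<bar>?g y - ?g x\<bar> \<le> \<eta> * \<bar>y - x\<bar>" if "x \<in> {-\<epsilon>..\<epsilon>}" "y \<in> {-\<epsilon>..\<epsilon>}" for x y
  proof -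
    have "norm (?g y - ?g x) \<le> \<eta> * norm (y - x)"
    proof (rule field_differentiable_bound)
      show "(?g has_field_derivative nderiv_on 1 {-\<epsilon>..\<epsilon>} ?g t) (at t within {-\<epsilon>..\<epsilon>})"
        if "t \<in> {-\<epsilon>..\<epsilon>}" for t
        using nderiv_on_has_derivative[OF g, of 0 t] that assms(3) by simp
    qed (use le[of 1] assms(3) that in auto)
    then show ?thesis by simp
  qed
  show "continuous_on {-\<epsilon>..\<epsilon>} f"
    using C_on_mono[OF assms(1), of 0] by (simp add: C_on_def)
qed (use assms in auto)

section \<open>Interpolation polynomials\<close>

lemma interpolating_poly_exists:
  fixes x y :: "nat \<Rightarrow> real"
  assumes "inj_on x {..k}"
  shows "\<exists>P. degree P \<le> k \<and> (\<forall>i\<le>k. poly P (x i) = y i)"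
  using assms
proof (induction k)
  case 0
  show ?case by (rule exI[of _ "[:y 0:]"]) auto
next
  case (Suc k)
  have "inj_on x {..k}" using Suc.prems by (rule inj_on_subset) auto
  then obtain P where P: "degree P \<le> k" "\<forall>i\<le>k. poly P (x i) = y i"
    using Suc.IH by blast
  define N where "N = (\<Prod>i\<le>k. [:- x i, 1:])"
  have N: "poly N t = (\<Prod>i\<le>k. t - x i)" for t by (simp add: N_def poly_prod)
  have "degree N \<le> Suc k"
    unfolding N_def using degree_prod_sum_le[of "{..k}" "\<lambda>i. [:- x i, 1:]"] by simp
  moreover have "poly N (x (Suc k)) \<noteq> 0"
    using Suc.prems by (fastforce simp: N inj_on_def)
  moreover have "poly N (x i) = 0" if "i \<le> k" for i
    using that by (auto simp: N)
  moreover define c where "c = (y (Suc k) - poly P (x (Suc k))) / poly N (x (Suc k))"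
  ultimately have "degree (P + smult c N) \<le> Suc k \<and> (\<forall>i\<le>Suc k. poly (P + smult c N) (x i) = y i)"
    using P degree_smult_le[of c N] by (auto intro!: degree_add_le elim: le_SucE)
  then show ?case by blast
qed

lemma divided_difference_eq_coeff:
  assumes "inj_on x {..k}"
  shows "\<exists>P. degree P \<le> k \<and> (\<forall>i\<le>k. poly P (x i) = y i) \<and> divided_difference k x y = coeff P k"
proof -
  let ?I = "\<lambda>P. degree P \<le> k \<and> (\<forall>i\<le>k. poly P (x i) = y i)"
  have unique: "P = Q" if P: "?I P" and Q: "?I Q" for P Q
  proof (rule ccontr)
    assume "P \<noteq> Q"
    then have "card {t. poly (P - Q) t = 0} \<le> degree (P - Q)" "finite {t. poly (P - Q) t = 0}"
      by (auto intro!: card_poly_roots_bound poly_roots_finite simp del: poly_diff)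
    moreover have "degree (P - Q) \<le> k" using P Q by (auto intro: degree_diff_le)
    moreover have "x ` {..k} \<subseteq> {t. poly (P - Q) t = 0}" using P Q by auto
    ultimately show False
      using card_mono[of "{t. poly (P - Q) t = 0}" "x ` {..k}"] assms by (simp add: card_image)
  qed
  obtain P where P: "?I P" using interpolating_poly_exists[OF assms] by blast
  then have "(THE P. ?I P) = P" by (rule the_equality) (rule unique[OF _ P])
  then have "divided_difference k x y = coeff P k" by (simp add: divided_difference_def)
  with P show ?thesis by blast
qed

section \<open>Uniform estimate over all configurations\<close>

text \<open>
  A configuration consists of the functions \<open>h0\<close>, \<open>f\<close> and \<open>h\<close>, the number \<open>\<eta>\<close> and the starting point
  of the second orbit.
\<close>

type_synonym configuration =
  "(real \<Rightarrow> real) \<times> (real \<Rightarrow> real) \<times> (real \<Rightarrow> real) \<times> real \<times> real"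

definition admissible :: "nat \<Rightarrow> real \<Rightarrow> real \<Rightarrow> configuration set" where
  "admissible k \<epsilon> M = {(h0, f, h, \<eta>, x).
     C_on (k + 1) {-\<epsilon>..\<epsilon>} h0 \<and> C_on k {-\<epsilon>..\<epsilon>} f \<and> C_on k {-\<epsilon>..\<epsilon>} h \<and>
     C_norm (k + 1) {-\<epsilon>..\<epsilon>} h0 \<le> M \<and> 0 < \<eta> \<and>
     C_norm k {-\<epsilon>..\<epsilon>} (\<lambda>x. h x - h0 x) < \<eta> \<and> C_norm k {-\<epsilon>..\<epsilon>} (\<lambda>x. f x - x) < \<eta> \<and>
     0 < f 0 \<and> \<bar>x\<bar> \<le> 2 ^ (2 * k + 1) * f 0}"

text \<open>
  The smooth part is expanded to degree \<open>k\<close>, with a remainder of order \<open>k + 1\<close>, but the perturbation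
  \<open>q\<close>, which has only \<open>k\<close> derivatives, to degree \<open>k - 1\<close>. Its remainder is nevertheless small because its
  \<open>k\<close>-th derivative is, and the coefficient of \<open>t\<^sup>k\<close> involves the smooth part alone.
\<close>

lemma taylor_sum_at_0:
  assumes "C_on (k + 1) {-\<epsilon>..\<epsilon>} h0" "C_on k {-\<epsilon>..\<epsilon>} q" "\<bar>t\<bar> < \<epsilon>"
  shows "\<bar>(h0 t + q t) - (\<Sum>l\<le>k. (nderiv_on l {-\<epsilon>..\<epsilon>} h0 0 / fact l +
      (if l < k then nderiv_on l {-\<epsilon>..\<epsilon>} q 0 / fact l else 0)) * t ^ l)\<bar>
    \<le> C_norm (k + 1) {-\<epsilon>..\<epsilon>} h0 * \<bar>t\<bar> ^ (k + 1) + C_norm k {-\<epsilon>..\<epsilon>} q * \<bar>t\<bar> ^ k"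
proof -
  have "(\<Sum>l\<le>k. (nderiv_on l {-\<epsilon>..\<epsilon>} h0 0 / fact l +
      (if l < k then nderiv_on l {-\<epsilon>..\<epsilon>} q 0 / fact l else 0)) * t ^ l)
    = (\<Sum>l<k+1. nderiv_on l {-\<epsilon>..\<epsilon>} h0 0 / fact l * t ^ l)
      + (\<Sum>l<k. nderiv_on l {-\<epsilon>..\<epsilon>} q 0 / fact l * t ^ l)"
    by (simp add: distrib_right sum.distrib flip: lessThan_Suc_atMost)
  then show ?thesis
    using taylor_at_0[OF assms(1,3)] taylor_at_0[OF assms(2,3)] by linarith
qed

text \<open>
  The filter \<open>F\<close> in the proof describes \<open>\<eta> \<rightarrow> 0\<close> over all admissible configurations at once. A Landau bound
  along it is a bound with one constant for all of them, valid once \<open>\<eta>\<close> is below one threshold.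
\<close>

theorem uniform_divided_difference_bound:
  fixes k :: nat and \<epsilon> M :: real
  assumes k: "2 \<le> k" and \<epsilon>: "0 < \<epsilon>"
  shows "\<exists>C. \<exists>e>0. \<forall>h0 f h \<eta> x. (h0, f, h, \<eta>, x) \<in> admissible k \<epsilon> M \<longrightarrow> \<eta> < e \<longrightarrow>
    \<bar>divided_difference k (\<lambda>j. (f ^^ j) 0) (\<lambda>j. h ((f ^^ j) x))
      - nderiv_on k {-\<epsilon>..\<epsilon>} h0 0 / fact k\<bar> \<le> C * \<eta>"
proof -
  let ?I = "{-\<epsilon>..\<epsilon>}"
  define h0 f h :: "configuration \<Rightarrow> real \<Rightarrow> real"
    where "h0 = (\<lambda>p. fst p)" and "f = (\<lambda>p. fst (snd p))" and "h = (\<lambda>p. fst (snd (snd p)))"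
  define \<eta> x :: "configuration \<Rightarrow> real"
    where "\<eta> = (\<lambda>p. fst (snd (snd (snd p))))" and "x = (\<lambda>p. snd (snd (snd (snd p))))"
  define F where "F = inf (filtercomap \<eta> (at_right 0)) (principal (admissible k \<epsilon> M))"
  have ev: "eventually P F \<longleftrightarrow> (\<exists>e>0. \<forall>p\<in>admissible k \<epsilon> M. \<eta> p < e \<longrightarrow> P p)" for P
  proof -
    have pos: "0 < \<eta> p" if "p \<in> admissible k \<epsilon> M" for p
      using that by (auto simp: admissible_def \<eta>_def)
    have "eventually P F \<longleftrightarrow>
      (\<exists>Q. (\<exists>e>0. \<forall>y>0. y < e \<longrightarrow> Q y) \<and> (\<forall>p. Q (\<eta> p) \<longrightarrow> p \<in> admissible k \<epsilon> M \<longrightarrow> P p))"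
      by (simp add: F_def eventually_inf_principal eventually_filtercomap eventually_at_right_field)
    also have "\<dots> \<longleftrightarrow> (\<exists>e>0. \<forall>p\<in>admissible k \<epsilon> M. \<eta> p < e \<longrightarrow> P p)" (is "?L \<longleftrightarrow> ?R")
    proof
      assume ?L
      then show ?R using pos by blast
    next
      assume ?R
      then obtain e where e: "e > 0" "\<forall>p\<in>admissible k \<epsilon> M. \<eta> p < e \<longrightarrow> P p" by blast
      then show ?L by (intro exI[of _ "\<lambda>y. y < e"]) auto
    qed
    finally show ?thesis .
  qed
  \<comment> \<open>Below \<open>e0\<close> the orbits stay inside the interval and the gaps are at least half of \<open>f(0)\<close>.\<close>
  define e0 where "e0 = min \<epsilon> 1 / 2 ^ (3 * k + 3)"
  have e0: "0 < e0" using \<epsilon> by (simp add: e0_def)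
  define G where "G = {p \<in> admissible k \<epsilon> M. \<eta> p < e0}"
  have G: "\<forall>\<^sub>F p in F. p \<in> G" unfolding ev G_def using e0 by auto
  have G_bigo: "u \<in> O[F](v)" if "\<And>p. p \<in> G \<Longrightarrow> \<bar>u p\<bar> \<le> c * \<bar>v p\<bar>" for u v :: "_ \<Rightarrow> real" and c
    by (rule bigoI[of _ c]) (use G that in \<open>auto elim!: eventually_mono\<close>)
  define \<Lambda> :: real where "\<Lambda> = 2 ^ (3 * k + 2)"
  define g q where "g = (\<lambda>p x. f p x - x)" and "q = (\<lambda>p x. h p x - h0 p x)"
  have facts: "C_on (k + 1) ?I (h0 p)" "C_on k ?I (f p)" "C_on k ?I (g p)" "C_on k ?I (q p)"
      "C_norm (k + 1) ?I (h0 p) \<le> M" "C_norm k ?I (q p) < \<eta> p" "C_norm k ?I (g p) < \<eta> p"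
      "0 < f p 0" "\<bar>x p\<bar> \<le> 2 ^ (2 * k + 1) * f p 0" "0 < \<eta> p"
      "2 ^ (3 * k + 3) * \<eta> p \<le> \<epsilon>" "2 ^ (3 * k + 3) * \<eta> p \<le> 1"
    if "p \<in> G" for p
  proof -
    obtain h0' f' h' \<eta>' x' where p: "p = (h0', f', h', \<eta>', x')" by (cases p) auto
    show *: "C_on (k + 1) ?I (h0 p)" "C_on k ?I (f p)"
      "C_norm (k + 1) ?I (h0 p) \<le> M" "C_norm k ?I (q p) < \<eta> p" "C_norm k ?I (g p) < \<eta> p"
      "0 < f p 0" "\<bar>x p\<bar> \<le> 2 ^ (2 * k + 1) * f p 0" "0 < \<eta> p"
      using that unfolding G_def p
      by (auto simp: admissible_def h0_def f_def h_def \<eta>_def x_def g_def q_def)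
    have "C_on k ?I (h p)"
      using that unfolding G_def p by (auto simp: admissible_def h_def)
    then show "C_on k ?I (q p)"
      unfolding q_def using \<epsilon> C_on_mono[OF *(1)] by (intro C_on_diff) auto
    show "C_on k ?I (g p)"
      unfolding g_def using \<epsilon> *(2) by (intro C_on_diff C_on_ident) auto
    have "\<eta> p < e0" using that by (simp add: G_def)
    then have "2 ^ (3 * k + 3) * \<eta> p \<le> min \<epsilon> 1"
      by (simp add: e0_def field_simps)
    then show "2 ^ (3 * k + 3) * \<eta> p \<le> \<epsilon>" "2 ^ (3 * k + 3) * \<eta> p \<le> 1" by auto
  qed
  have near: "near_identity \<epsilon> (\<eta> p) (f p)" if "p \<in> G" for p
  proof (rule near_identity_if_C_norm[where r = k])
    have "2 * \<eta> p \<le> 2 ^ (3 * k + 3) * \<eta> p"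
      using facts(10)[OF that] power_increasing[of 1 "3 * k + 3" "2::real"]
      by (intro mult_right_mono) auto
    then show "\<eta> p \<le> 1 / 2" "\<eta> p \<le> \<epsilon> / 2" using facts(11,12)[OF that] by auto
  qed (use facts[OF that] k \<epsilon> in \<open>auto simp: g_def\<close>)
  define z zt where "z = (\<lambda>p j. (f p ^^ j) 0)" and "zt = (\<lambda>p j. (f p ^^ j) (x p))"
  have z: "\<bar>z p j\<bar> \<le> \<Lambda> * f p 0" "\<bar>z p j\<bar> < \<epsilon>"
    and zt: "\<bar>zt p j\<bar> \<le> \<Lambda> * f p 0" "\<bar>zt p j\<bar> < \<epsilon>" if "p \<in> G" "j \<le> k" for p j
    using near_identity.orbit_bound(3,4)[OF near[OF that(1)] facts(11)[OF that(1)], of 0 j]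
      near_identity.orbit_bound(3,4)[OF near[OF that(1)] facts(11,9)[OF that(1)], of j]
      facts(8)[OF that(1)] that(2) \<epsilon>
    by (auto simp: z_def zt_def \<Lambda>_def)
  have power_le: "\<bar>t\<bar> ^ n \<le> \<Lambda> ^ n * f p 0 ^ n" if "\<bar>t\<bar> \<le> \<Lambda> * f p 0" for t p n
    using power_mono[OF that, of n] by (simp add: power_mult_distrib)
  define a where "a = (\<lambda>l p. nderiv_on l ?I (g p) 0 / fact l)"
  have step_bigo: "(\<lambda>p. f p (t p) - t p - (\<Sum>l<k. a l p * t p ^ l)) \<in> O[F](\<lambda>p. \<eta> p * f p 0 ^ k)"
    if t: "\<And>p. p \<in> G \<Longrightarrow> \<bar>t p\<bar> \<le> \<Lambda> * f p 0" "\<And>p. p \<in> G \<Longrightarrow> \<bar>t p\<bar> < \<epsilon>" for t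
  proof (rule G_bigo[of _ "\<Lambda> ^ k"])
    fix p assume p: "p \<in> G"
    have "\<bar>f p (t p) - t p - (\<Sum>l<k. a l p * t p ^ l)\<bar> \<le> C_norm k ?I (g p) * \<bar>t p\<bar> ^ k"
      using taylor_at_0[OF facts(3)[OF p] t(2)[OF p]] by (simp add: g_def a_def)
    also have "\<dots> \<le> \<eta> p * (\<Lambda> ^ k * f p 0 ^ k)"
      using facts(7,10)[OF p] power_le[OF t(1)[OF p]] by (intro mult_mono) auto
    finally show "\<bar>f p (t p) - t p - (\<Sum>l<k. a l p * t p ^ l)\<bar> \<le> \<Lambda> ^ k * \<bar>\<eta> p * f p 0 ^ k\<bar>"
      using facts(8,10)[OF p] by (simp add: mult_ac abs_mult)
  qed
  interpret orbit_pair_family F k z zt "\<lambda>p. f p 0" \<eta> a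
  proof
    show "(\<eta> \<longlongrightarrow> 0) F"
    proof (rule tendstoI)
      fix e :: real assume "0 < e"
      show "\<forall>\<^sub>F p in F. dist (\<eta> p) 0 < e"
        unfolding ev using \<open>0 < e\<close> by (intro exI[of _ e]) (auto simp: admissible_def \<eta>_def)
    qed
    show "\<forall>\<^sub>F p in F. 0 < f p 0" using G by eventually_elim (rule facts)
    show "(\<lambda>p. f p 0) \<in> O[F](\<eta>)"
      by (rule G_bigo[of _ 1]) (use near_identity.f0_le[OF near] facts in fastforce)
    show "(\<lambda>p. z p j) \<in> O[F](\<lambda>p. f p 0)" "(\<lambda>p. zt p j) \<in> O[F](\<lambda>p. f p 0)" if "j \<le> k" for j
      by (rule G_bigo[of _ \<Lambda>], use z(1) zt(1) facts(8) that in fastforce)+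
    show "\<forall>\<^sub>F p in F. f p 0 \<le> 2 * (z p (Suc j) - z p j)" if "j < k" for j
      using G
    proof eventually_elim
      case (elim p)
      show ?case
        unfolding z_def by (rule near_identity.orbit_gap[OF near facts(11,12)]) (use elim that in auto)
    qed
    show "a l \<in> O[F](\<eta>)" if "l < k" for l
    proof (rule G_bigo[of _ 1])
      fix p assume p: "p \<in> G"
      have "\<bar>a l p\<bar> \<le> \<bar>nderiv_on l ?I (g p) 0\<bar>"
        by (simp add: a_def divide_le_eq mult_le_cancel_left1)
      also have "\<dots> \<le> C_norm k ?I (g p)"
        using nderiv_on_le_C_norm[OF facts(3)[OF p], of l 0] that \<epsilon> by auto
      finally show "\<bar>a l p\<bar> \<le> 1 * \<bar>\<eta> p\<bar>" using facts(7)[OF p] by simp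
    qed
    show "(\<lambda>p. z p (Suc j) - z p j - (\<Sum>l<k. a l p * z p j ^ l)) \<in> O[F](\<lambda>p. \<eta> p * f p 0 ^ k)"
      if "j < k" for j
      using step_bigo[of "\<lambda>p. z p j"] z that by (simp add: z_def)
    show "(\<lambda>p. zt p (Suc j) - zt p j - (\<Sum>l<k. a l p * zt p j ^ l)) \<in> O[F](\<lambda>p. \<eta> p * f p 0 ^ k)"
      if "j < k" for j
      using step_bigo[of "\<lambda>p. zt p j"] zt that by (simp add: zt_def)
  qed (simp add: z_def)
  define b where "b = (\<lambda>l p. nderiv_on l ?I (h0 p) 0 / fact l +
      (if l < k then nderiv_on l ?I (q p) 0 / fact l else 0))"
  define D where "D = (\<lambda>p. divided_difference k (z p) (\<lambda>j. h p (zt p j)))"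
  have "\<exists>P. \<forall>p\<in>G. degree (P p) \<le> k \<and> (\<forall>j\<le>k. poly (P p) (z p j) = h p (zt p j)) \<and> D p = coeff (P p) k"
  proof (intro bchoice ballI)
    fix p assume p: "p \<in> G"
    have "strict_mono_on {..k} (z p)"
      unfolding z_def using near_identity.orbit_strict_mono[OF near facts(11,12)] p
      by (intro strict_mono_onI) auto
    then have "inj_on (z p) {..k}" by (rule strict_mono_on_imp_inj_on)
    then show "\<exists>P. degree P \<le> k \<and> (\<forall>j\<le>k. poly P (z p j) = h p (zt p j)) \<and> D p = coeff P k"
      unfolding D_def by (rule divided_difference_eq_coeff)
  qed
  then obtain P where P: "\<forall>p\<in>G. degree (P p) \<le> k \<and>
      (\<forall>j\<le>k. poly (P p) (z p j) = h p (zt p j)) \<and> D p = coeff (P p) k" ..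
  have "(\<lambda>p. coeff (P p) k - b k p) \<in> O[F](\<eta>)"
  proof (rule interpolation_leading_coefficient[where b = b and P = P
      and y = "\<lambda>p j. h p (zt p j)"])
    show "b l \<in> O[F](\<lambda>_. 1)" if "l \<le> k" for l
    proof (rule G_bigo[of _ "M + 1"])
      fix p assume p: "p \<in> G"
      have le: "\<bar>u / fact l\<bar> \<le> \<bar>u\<bar>" for u :: real
        by (simp add: divide_le_eq mult_le_cancel_left1)
      have "\<bar>nderiv_on l ?I (h0 p) 0\<bar> \<le> M"
        using nderiv_on_le_C_norm[OF facts(1)[OF p], of l 0] facts(5)[OF p] that \<epsilon> by auto
      moreover have "\<bar>nderiv_on l ?I (q p) 0\<bar> \<le> 1"
      proof -
        have "\<eta> p \<le> 1" using near_identity.\<eta>_small(1)[OF near[OF p]] by simp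
        then show ?thesis
          using nderiv_on_le_C_norm[OF facts(4)[OF p], of l 0] facts(6)[OF p] that \<epsilon> by auto
      qed
      ultimately show "\<bar>b l p\<bar> \<le> (M + 1) * \<bar>1\<bar>"
        using le[of "nderiv_on l ?I (h0 p) 0"] le[of "nderiv_on l ?I (q p) 0"]
        unfolding b_def by (simp only: mult_1_right abs_one split: if_split) linarith
    qed
    show "(\<lambda>p. h p (zt p j) - (\<Sum>l\<le>k. b l p * zt p j ^ l)) \<in> O[F](\<lambda>p. \<eta> p * f p 0 ^ k)"
      if "j \<le> k" for j
    proof (rule G_bigo[of _ "\<bar>M\<bar> * \<Lambda> ^ (k + 1) + \<Lambda> ^ k"])
      fix p assume p: "p \<in> G"
      note t = zt[OF p that]
      have "\<bar>h p (zt p j) - (\<Sum>l\<le>k. b l p * zt p j ^ l)\<bar>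
        \<le> C_norm (k + 1) ?I (h0 p) * \<bar>zt p j\<bar> ^ (k + 1) + C_norm k ?I (q p) * \<bar>zt p j\<bar> ^ k"
        using taylor_sum_at_0[OF facts(1,4)[OF p] t(2)] by (simp add: q_def b_def)
      moreover have "C_norm (k + 1) ?I (h0 p) * \<bar>zt p j\<bar> ^ (k + 1)
        \<le> \<bar>M\<bar> * (\<Lambda> ^ (k + 1) * (\<eta> p * f p 0 ^ k))"
      proof (rule mult_mono)
        have "f p 0 * f p 0 ^ k \<le> \<eta> p * f p 0 ^ k"
          using near_identity.f0_le[OF near[OF p]] facts(8)[OF p] by (intro mult_right_mono) auto
        then have "\<Lambda> ^ (k + 1) * f p 0 ^ (k + 1) \<le> \<Lambda> ^ (k + 1) * (\<eta> p * f p 0 ^ k)"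
          by (intro mult_left_mono) (auto simp: \<Lambda>_def)
        with power_le[OF t(1), of "k + 1"]
        show "\<bar>zt p j\<bar> ^ (k + 1) \<le> \<Lambda> ^ (k + 1) * (\<eta> p * f p 0 ^ k)" by (rule order_trans)
      qed (use facts(5)[OF p] in auto)
      moreover have "C_norm k ?I (q p) * \<bar>zt p j\<bar> ^ k \<le> \<eta> p * (\<Lambda> ^ k * f p 0 ^ k)"
        by (rule mult_mono) (use facts(6,10)[OF p] power_le[OF t(1), of k] in auto)
      ultimately have "\<bar>h p (zt p j) - (\<Sum>l\<le>k. b l p * zt p j ^ l)\<bar>
        \<le> \<bar>M\<bar> * (\<Lambda> ^ (k + 1) * (\<eta> p * f p 0 ^ k)) + \<eta> p * (\<Lambda> ^ k * f p 0 ^ k)"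
        by linarith
      also have "\<dots> = (\<bar>M\<bar> * \<Lambda> ^ (k + 1) + \<Lambda> ^ k) * (\<eta> p * f p 0 ^ k)"
        by (simp add: algebra_simps)
      finally show "\<bar>h p (zt p j) - (\<Sum>l\<le>k. b l p * zt p j ^ l)\<bar>
        \<le> (\<bar>M\<bar> * \<Lambda> ^ (k + 1) + \<Lambda> ^ k) * \<bar>\<eta> p * f p 0 ^ k\<bar>"
        using facts(8,10)[OF p] by simp
    qed
    show "\<forall>\<^sub>F p in F. degree (P p) \<le> k \<and> (\<forall>j\<le>k. poly (P p) (z p j) = h p (zt p j))"
      using G by eventually_elim (use P in blast)
  qed (use k in auto)
  then obtain C where "\<forall>\<^sub>F p in F. norm (coeff (P p) k - b k p) \<le> C * norm (\<eta> p)"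
    by (auto elim: landau_o.bigE)
  with G have "\<forall>\<^sub>F p in F. \<bar>D p - nderiv_on k ?I (h0 p) 0 / fact k\<bar> \<le> C * \<eta> p"
  proof eventually_elim
    case (elim p)
    then show ?case using P facts(10)[of p] by (simp add: b_def)
  qed
  then obtain e where e: "e > 0" "\<And>p. p \<in> admissible k \<epsilon> M \<Longrightarrow> \<eta> p < e \<Longrightarrow>
    \<bar>D p - nderiv_on k ?I (h0 p) 0 / fact k\<bar> \<le> C * \<eta> p"
    unfolding ev by blast
  show ?thesis
  proof (rule exI[of _ C], rule exI[of _ e], intro conjI allI impI)
    show "0 < e" by (rule e(1))
  next
    fix h0' f' h' :: "real \<Rightarrow> real" and \<eta>' x' :: real
    assume "(h0', f', h', \<eta>', x') \<in> admissible k \<epsilon> M" "\<eta>' < e"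
    then show "\<bar>divided_difference k (\<lambda>j. (f' ^^ j) 0) (\<lambda>j. h' ((f' ^^ j) x'))
        - nderiv_on k ?I h0' 0 / fact k\<bar> \<le> C * \<eta>'"
      using e(2)[of "(h0', f', h', \<eta>', x')"]
      by (simp add: D_def z_def zt_def h0_def f_def h_def \<eta>_def x_def)
  qed
qed

theorem proposition1p6:
  fixes k :: nat and \<epsilon> Bk1 :: real
  assumes "2 \<le> k" and "0 < \<epsilon>" and "0 < Bk1"
  shows "\<exists>C>1. \<forall>(Bk::real) (h0::real \<Rightarrow> real) (f::real \<Rightarrow> real) (h::real \<Rightarrow> real) (\<eta>::real).
    (let I = {-\<epsilon>..\<epsilon>};
         B = nderiv_on k I h0 0;
         z = (\<lambda>j::int. iterate_on I f j 0)
     in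
      0 < Bk \<and> Bk \<le> Bk1 \<and>
      C_infinity_on I h0 \<and> C_on k I f \<and> C_on k I h \<and>
      C_norm (k + 1) I h0 \<le> Bk1 \<and> \<bar>B\<bar> \<ge> Bk \<and>
      0 < \<eta> \<and> \<eta> < min 1 Bk / (2 * C) \<and>
      C_norm k I (\<lambda>x. h x - h0 x) < \<eta> \<and>
      C_norm k I (\<lambda>x. f x - x) < \<eta> \<and>
      f 0 > 0
      \<longrightarrow>
      (\<forall>j. \<bar>j\<bar> \<le> 2 * int k \<longrightarrow> iterate_defined I f j 0 \<and> z j \<in> {-\<epsilon><..<\<epsilon>}) \<and>
      strict_mono_on {0..int k} z \<and>
      (\<forall>zt0 \<in> {z (- 2 * int k)<..<z (2 * int k)}.
        let zt = (\<lambda>j::int. iterate_on I f j zt0);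
            D = divided_difference k (\<lambda>i. z (int i)) (\<lambda>i. h (zt (int i)))
        in
          (\<forall>j. 0 \<le> j \<and> j \<le> int k \<longrightarrow> iterate_defined I f j zt0 \<and> zt j \<in> {-\<epsilon><..<\<epsilon>}) \<and>
          (B - C * \<eta>) / fact k < D \<and> D < (B + C * \<eta>) / fact k \<and>
          sgn D = sgn B \<and> D \<noteq> 0))"
proof -
  obtain C1 e where e: "0 < e" and bound: "\<forall>h0 f h \<eta> x. (h0, f, h, \<eta>, x) \<in> admissible k \<epsilon> Bk1 \<longrightarrow>
      \<eta> < e \<longrightarrow> \<bar>divided_difference k (\<lambda>j. (f ^^ j) 0) (\<lambda>j. h ((f ^^ j) x))
        - nderiv_on k {-\<epsilon>..\<epsilon>} h0 0 / fact k\<bar> \<le> C1 * \<eta>"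
    using uniform_divided_difference_bound[OF assms(1,2), where M = Bk1] by blast
  \<comment> \<open>The summands provide, in turn, \<open>C > 1\<close>, a strict form of the uniform bound, its threshold for \<open>\<eta>\<close>,
      orbits that stay inside the interval, and positive gaps.\<close>
  define C where "C = 2 + fact k * (\<bar>C1\<bar> + 1) + 1 / e + 2 ^ (3 * k + 3) / \<epsilon> + 2 ^ (3 * k + 3)"
  have C: "1 < C" "fact k * (\<bar>C1\<bar> + 1) \<le> C" "1 / e \<le> C" "2 ^ (3 * k + 3) / \<epsilon> \<le> C" "2 ^ (3 * k + 3) \<le> C"
  proof -
    have "0 \<le> fact k * (\<bar>C1\<bar> + 1)" "0 \<le> 1 / e" "0 \<le> 2 ^ (3 * k + 3) / \<epsilon>" "(0::real) \<le> 2 ^ (3 * k + 3)"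
      using e assms(2) by simp_all
    then show "1 < C" "fact k * (\<bar>C1\<bar> + 1) \<le> C" "1 / e \<le> C" "2 ^ (3 * k + 3) / \<epsilon> \<le> C"
      "2 ^ (3 * k + 3) \<le> C" unfolding C_def by linarith+
  qed
  show ?thesis
  proof (intro exI[of _ C] conjI allI, goal_cases)
    case 1
    show ?case by (rule C(1))
  next
    case (2 Bk h0 f h \<eta>)
    let ?I = "{-\<epsilon>..\<epsilon>}"
    show ?case
      unfolding Let_def
    proof (intro impI, elim conjE, goal_cases)
      case 1
      have "min 1 Bk / (2 * C) \<le> 1 / (2 * C)" "min 1 Bk / (2 * C) \<le> Bk / (2 * C)"
        using C(1) by (auto intro: divide_right_mono)
      with 1(9) have "\<eta> < 1 / (2 * C)" "\<eta> < Bk / (2 * C)" by linarith+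
      then have C\<eta>: "C * \<eta> < 1 / 2" "C * \<eta> < Bk / 2"
        using C(1) by (simp_all add: field_simps)
      have small: "c * \<eta> < 1 / 2" if "c \<le> C" for c
        using mult_right_mono[OF that, of \<eta>] 1(8) C\<eta>(1) by linarith
      have \<eta>: "\<eta> < e" "2 ^ (3 * k + 3) * \<eta> \<le> \<epsilon>" "2 ^ (3 * k + 3) * \<eta> \<le> 1"
        using small[OF C(3)] small[OF C(4)] small[OF C(5)] e assms(2) by (simp_all add: field_simps)
      have "2 * \<eta> \<le> 2 ^ (3 * k + 3) * \<eta>"
        using 1(8) power_increasing[of 1 "3 * k + 3" "2::real"]
        by (intro mult_right_mono) auto
      then interpret near_identity \<epsilon> \<eta> f
        using near_identity_if_C_norm[OF 1(4) 1(11)] 1(12) \<eta> assms by simp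
      have "2 ^ (2 * k) * (\<bar>0\<bar> + 2 * f 0) \<le> \<epsilon> / 2"
      proof -
        have "2 ^ (2 * k) * (\<bar>0\<bar> + 2 * f 0) = 2 ^ (2 * k + 1) * f 0" by simp
        also have "\<dots> \<le> 2 ^ (3 * k + 2) * \<eta>"
          using f0_le f0_pos by (intro mult_mono power_increasing) auto
        also have "\<dots> = 2 ^ (3 * k + 3) * \<eta> / 2" by (simp add: power_add)
        finally show ?thesis using \<eta>(2) by simp
      qed
      note z_iterate = iterate_on_bound[OF this]
      have z_bound: "\<bar>iterate_on ?I f j 0\<bar> \<le> 2 ^ (2 * k + 1) * f 0" if "\<bar>j\<bar> \<le> 2 * int k" for j
      proof -
        have "2 ^ nat \<bar>j\<bar> * (\<bar>0\<bar> + 2 * f 0) \<le> 2 ^ (2 * k) * (\<bar>0\<bar> + 2 * f 0)"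
          using that f0_pos by (intro mult_right_mono power_increasing) auto
        also have "\<dots> = 2 ^ (2 * k + 1) * f 0" by simp
        moreover have "\<bar>j\<bar> \<le> int (2 * k)" using that by simp
        ultimately show ?thesis using z_iterate(3)[of j] f0_pos by linarith
      qed
      have Z_eq: "iterate_on ?I f j t = (f ^^ nat j) t" if "0 \<le> j" for j t
        using that by (simp add: iterate_on_def)
      show ?case
      proof (intro conjI allI impI ballI)
        fix j :: int assume j: "\<bar>j\<bar> \<le> 2 * int k"
        then show "iterate_defined ?I f j 0" "iterate_on ?I f j 0 \<in> {-\<epsilon><..<\<epsilon>}"
          using z_iterate(1,2)[of j] \<epsilon>_pos by auto
      next
        show "strict_mono_on {0..int k} (\<lambda>j. iterate_on ?I f j 0)"
          using orbit_strict_mono[OF \<eta>(2,3)] by (intro strict_mono_onI) (auto simp: Z_eq)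
      next
        fix x assume x: "x \<in> {iterate_on ?I f (- 2 * int k) 0<..<iterate_on ?I f (2 * int k) 0}"
        have x_le: "\<bar>x\<bar> \<le> 2 ^ (2 * k + 1) * f 0"
          using x z_bound[of "- 2 * int k"] z_bound[of "2 * int k"] by auto
        note x_iterate = iterate_on_bound[OF orbit_bound(2)[OF \<eta>(2) x_le]]
        {
          fix j assume "0 \<le> j \<and> j \<le> int k"
          then show "iterate_defined ?I f j x" "iterate_on ?I f j x \<in> {-\<epsilon><..<\<epsilon>}"
            using x_iterate(1,2)[of j] \<epsilon>_pos by auto
        }
        define B where "B = nderiv_on k ?I h0 0"
        define D where "D = divided_difference k (\<lambda>i. iterate_on ?I f (int i) 0)
          (\<lambda>i. h (iterate_on ?I f (int i) x))"
        have "(h0, f, h, \<eta>, x) \<in> admissible k \<epsilon> Bk1"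
          using 1 x_le by (auto simp: admissible_def C_infinity_on_def)
        then have "\<bar>D - B / fact k\<bar> \<le> C1 * \<eta>"
          using bound \<eta>(1) by (simp add: D_def B_def Z_eq)
        also have "C1 * \<eta> < C / fact k * \<eta>"
        proof (rule mult_strict_right_mono)
          have "C1 < \<bar>C1\<bar> + 1" by simp
          also have "\<dots> \<le> C / fact k" using C(2) by (simp add: field_simps)
          finally show "C1 < C / fact k" .
        qed (rule 1)
        finally have close: "\<bar>D - B / fact k\<bar> < C * \<eta> / fact k" by simp
        then show lower: "(nderiv_on k ?I h0 0 - C * \<eta>) / fact k
            < divided_difference k (\<lambda>i. iterate_on ?I f (int i) 0) (\<lambda>i. h (iterate_on ?I f (int i) x))"
          and upper: "divided_difference k (\<lambda>i. iterate_on ?I f (int i) 0) (\<lambda>i. h (iterate_on ?I f (int i) x))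
            < (nderiv_on k ?I h0 0 + C * \<eta>) / fact k"
          unfolding B_def[symmetric] D_def[symmetric] diff_divide_distrib add_divide_distrib
          by linarith+
        \<comment> \<open>Since \<open>C \<eta> < \<bar>B\<bar>\<close>, the interval that contains the divided difference avoids \<open>0\<close>.\<close>
        have "C * \<eta> < \<bar>B\<bar>"
          using C\<eta>(2) 1(1,7) by (simp add: B_def)
        moreover have "0 < C * \<eta>" using C(1) 1(8) by simp
        ultimately have "(0 < B \<and> 0 < (B - C * \<eta>) / fact k) \<or> (B < 0 \<and> (B + C * \<eta>) / fact k < 0)"
          by (auto simp: divide_less_0_iff abs_if split: if_splits)
        then have "0 < B \<and> 0 < D \<or> B < 0 \<and> D < 0"
          using lower upper unfolding B_def[symmetric] D_def[symmetric] by linarith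
        then show "sgn (divided_difference k (\<lambda>i. iterate_on ?I f (int i) 0) (\<lambda>i. h (iterate_on ?I f (int i) x)))
            = sgn (nderiv_on k ?I h0 0)"
          "divided_difference k (\<lambda>i. iterate_on ?I f (int i) 0) (\<lambda>i. h (iterate_on ?I f (int i) x)) \<noteq> 0"
          unfolding B_def[symmetric] D_def[symmetric] by auto
      qed
    qed
  qed
qed

end
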